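(* Let $p>0$, let $n\ge 1$, let $A_1,\ldots,A_n\in\mathbb{R}^3$ and $\zeta_1,\ldots,\zeta_n\in\mathbb{R}$, and let $$V_p(X)=\sum_{j=1}^n\frac{\zeta_j}{|X-A_j|^p}.$$ Fix an affine line $L\subset\mathbb{R}^3$. With the notation of the context, $V_p|_L(x)=\sum_{j=1}^n \zeta_j\big((x-a_j)^2+b_j^2\big)^{-p/2}$. Combine all charges which induce the same pair $(a_j,|b_j|)$ by adding their coefficients, and omit those for which the resulting coefficient vanishes. Let $N$ be the number of nonzero charges that remain (so the remaining pairs $(a_j,|b_j|)$ are pairwise distinct, each with a nonzero coefficient). If $N\ge 1$, then the restriction $V_p|_L$ has at most $$2N-1\le 2n-1$$ distinct critical points in its domain. If $N=0$, then $V_p|_L\equiv 0$.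
   Context: Choose an affine coordinate $x$ on $L$ that is an isometry of $L$ with $\mathbb{R}$. For each $j$, $a_j\in\mathbb{R}$ is the coordinate of the orthogonal projection of $A_j$ onto $L$, and $|b_j|\ge 0$ is the distance from $A_j$ to $L$. After combining charges, the restriction is regarded as the function $x\mapsto\sum_j \zeta_j\big((x-a_j)^2+b_j^2\big)^{-p/2}$, the sum running over the $N$ remaining combined charges (with $\zeta_j$ now the combined coefficients). Its domain is $\mathbb{R}\setminus\{a_j : b_j=0\}$, with $j$ ranging over the remaining charges. A critical point of the restriction is a point of this domain at which its derivative with respect to $x$ vanishes. *)

theory Defs
  imports "HOL-Analysis.Analysis"
begin

(* At a charge the value is an artefact of division by zero being zero. *)
definition point_charge_potential ::
    "real \<Rightarrow> nat \<Rightarrow> (nat \<Rightarrow> real ^ 3) \<Rightarrow> (nat \<Rightarrow> real) \<Rightarrow> real ^ 3 \<Rightarrow> real" where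
  "point_charge_potential p n A \<zeta> X = (\<Sum>j = 1..n. \<zeta> j / norm (X - A j) powr p)"

definition affine_line :: "(real ^ 3) set \<Rightarrow> bool" where
  "affine_line L \<longleftrightarrow> affine L \<and> aff_dim L = 1"

definition isometric_affine_coordinate :: "(real ^ 3) set \<Rightarrow> (real ^ 3 \<Rightarrow> real) \<Rightarrow> bool" where
  "isometric_affine_coordinate L c \<longleftrightarrow>
     bij_betw c L UNIV \<and>
     (\<forall>X\<in>L. \<forall>Y\<in>L. dist (c X) (c Y) = dist X Y) \<and>
     (\<forall>X\<in>L. \<forall>Y\<in>L. \<forall>t. c ((1 - t) *\<^sub>R X + t *\<^sub>R Y) = (1 - t) * c X + t * c Y)"

definition orthogonal_projection :: "(real ^ 3) set \<Rightarrow> real ^ 3 \<Rightarrow> real ^ 3" where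
  "orthogonal_projection L P = (THE Q. Q \<in> L \<and> (\<forall>X\<in>L. orthogonal (P - Q) (X - Q)))"

lemma orthogonal_projection_unique:
  fixes L :: "(real ^ 3) set"
  assumes "Q \<in> L" "\<forall>X\<in>L. orthogonal (P - Q) (X - Q)"
    and "R \<in> L" "\<forall>X\<in>L. orthogonal (P - R) (X - R)"
  shows "Q = R"
proof -
  have "(P - Q) \<bullet> (R - Q) = 0" "(P - R) \<bullet> (Q - R) = 0"
    using assms by (auto simp: orthogonal_def)
  then have "(R - Q) \<bullet> (R - Q) = 0"
    by (simp add: inner_diff_left inner_diff_right inner_commute)
  then show ?thesis by simp
qed

lemma orthogonal_projection_exists:
  fixes L :: "(real ^ 3) set"
  assumes "affine L" "L \<noteq> {}"
  shows "\<exists>Q\<in>L. \<forall>X\<in>L. orthogonal (P - Q) (X - Q)"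
proof (intro bexI ballI)
  have cl: "closed L" "convex L"
    using assms affine_closed affine_imp_convex by auto
  let ?Q = "closest_point L P"
  show Q: "?Q \<in> L" using cl assms closest_point_in_set by blast
  fix X assume X: "X \<in> L"
  have "2 *\<^sub>R ?Q + (-1) *\<^sub>R X \<in> L"
    using assms(1) Q X by (intro mem_affine) auto
  then have "(P - ?Q) \<bullet> (2 *\<^sub>R ?Q + (-1) *\<^sub>R X - ?Q) \<le> 0"
    using cl closest_point_dot by blast
  moreover have reflect: "2 *\<^sub>R ?Q + (-1) *\<^sub>R X - ?Q = - (X - ?Q)"
    by (simp add: scaleR_2)
  ultimately have "- ((P - ?Q) \<bullet> (X - ?Q)) \<le> 0"
    by (simp only: reflect inner_minus_right)
  moreover have "(P - ?Q) \<bullet> (X - ?Q) \<le> 0"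
    using cl X closest_point_dot by blast
  ultimately show "orthogonal (P - ?Q) (X - ?Q)"
    unfolding orthogonal_def by linarith
qed

lemma orthogonal_projection:
  fixes L :: "(real ^ 3) set"
  assumes "affine L" "L \<noteq> {}"
  shows "orthogonal_projection L P \<in> L"
    and "X \<in> L \<Longrightarrow> orthogonal (P - orthogonal_projection L P) (X - orthogonal_projection L P)"
proof -
  have "\<exists>!Q. Q \<in> L \<and> (\<forall>X\<in>L. orthogonal (P - Q) (X - Q))"
    using orthogonal_projection_exists[OF assms] orthogonal_projection_unique by blast
  from theI'[OF this] show "orthogonal_projection L P \<in> L"
    and "X \<in> L \<Longrightarrow> orthogonal (P - orthogonal_projection L P) (X - orthogonal_projection L P)"
    unfolding orthogonal_projection_def by blast+
qed

definition axial_coord :: "(real ^ 3) set \<Rightarrow> (real ^ 3 \<Rightarrow> real) \<Rightarrow> real ^ 3 \<Rightarrow> real" where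
  "axial_coord L c P = c (orthogonal_projection L P)"

(* The charge at P induces the pair (a, |b|); the second component is nonnegative. *)
definition induced_pair :: "(real ^ 3) set \<Rightarrow> (real ^ 3 \<Rightarrow> real) \<Rightarrow> real ^ 3 \<Rightarrow> real \<times> real" where
  "induced_pair L c P = (axial_coord L c P, infdist P L)"

definition combined_charge ::
    "(real ^ 3) set \<Rightarrow> (real ^ 3 \<Rightarrow> real) \<Rightarrow> nat \<Rightarrow> (nat \<Rightarrow> real ^ 3) \<Rightarrow> (nat \<Rightarrow> real)
      \<Rightarrow> real \<times> real \<Rightarrow> real" where
  "combined_charge L c n A \<zeta> q = (\<Sum>j | j \<in> {1..n} \<and> induced_pair L c (A j) = q. \<zeta> j)"

(* Each remaining combined charge is represented by the pair (a, |b|) it sits at. *)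
definition remaining_charges ::
    "(real ^ 3) set \<Rightarrow> (real ^ 3 \<Rightarrow> real) \<Rightarrow> nat \<Rightarrow> (nat \<Rightarrow> real ^ 3) \<Rightarrow> (nat \<Rightarrow> real)
      \<Rightarrow> (real \<times> real) set" where
  "remaining_charges L c n A \<zeta> =
     {q \<in> (\<lambda>j. induced_pair L c (A j)) ` {1..n}. combined_charge L c n A \<zeta> q \<noteq> 0}"

definition restricted_potential ::
    "real \<Rightarrow> (real ^ 3) set \<Rightarrow> (real ^ 3 \<Rightarrow> real) \<Rightarrow> nat \<Rightarrow> (nat \<Rightarrow> real ^ 3) \<Rightarrow> (nat \<Rightarrow> real)
      \<Rightarrow> real \<Rightarrow> real" where
  "restricted_potential p L c n A \<zeta> x =
     (\<Sum>(a, b) \<in> remaining_charges L c n A \<zeta>.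
        combined_charge L c n A \<zeta> (a, b) * ((x - a)\<^sup>2 + b\<^sup>2) powr (- p / 2))"

definition restriction_domain ::
    "(real ^ 3) set \<Rightarrow> (real ^ 3 \<Rightarrow> real) \<Rightarrow> nat \<Rightarrow> (nat \<Rightarrow> real ^ 3) \<Rightarrow> (nat \<Rightarrow> real) \<Rightarrow> real set" where
  "restriction_domain L c n A \<zeta> = UNIV - {a. (a, 0) \<in> remaining_charges L c n A \<zeta>}"

definition critical_points ::
    "real \<Rightarrow> (real ^ 3) set \<Rightarrow> (real ^ 3 \<Rightarrow> real) \<Rightarrow> nat \<Rightarrow> (nat \<Rightarrow> real ^ 3) \<Rightarrow> (nat \<Rightarrow> real)
      \<Rightarrow> real set" where
  "critical_points p L c n A \<zeta> =
     {x \<in> restriction_domain L c n A \<zeta>.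
        (restricted_potential p L c n A \<zeta> has_real_derivative 0) (at x)}"

end

theory Submission
  imports Defs "HOL-Complex_Analysis.Complex_Analysis" "HOL-Real_Asymp.Real_Asymp"
begin

text \<open>Write \<open>s = p / 2\<close>. On the line the potential is a sum of kernels \<open>((x - a)\<^sup>2 + b\<^sup>2) powr - s\<close>, and the idea is to
read it as the boundary values of a function on the half plane \<open>y \<ge> 0\<close> that has only saddles. Up to
the substitution \<open>y = t\<^sup>2\<close>, each kernel is the value on the axis of the potential of a ring charge: it
extends to a solution of the generalised axially symmetric equation
\<open>u\<^bsub>xx\<^esub> + 4 * y * u\<^bsub>yy\<^esub> + 2 * (1 + 2 * s) * u\<^bsub>y\<^esub> = 0\<close>, whose only singularity is a logarithmic pole at
\<open>(a, b\<^sup>2)\<close>. The extension is an explicit hypergeometric function (\<open>ring_kernel\<close>, \<open>kernel_PDE\<close>). The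
function \<open>x\<close> solves the same equation. Hence, for \<open>N\<close> off-axis charges, \<open>w = - e * x + \<close> the sum of the
extended kernels satisfies a weak maximum principle up to and including the axis, has \<open>N\<close> poles,
and looks like \<open>- e * x\<close> at infinity.

Such a \<open>w\<close> cannot have more than \<open>N\<close> separated maxima along the axis (\<open>card_axis_maxima_le\<close>). Let an
interval \<open>[l, r]\<close> of the axis have its maximum \<open>c\<close> in its interior. If \<open>l\<close> and \<open>r\<close> can be joined by a
path inside \<open>w < c\<close>, then the superlevel region that grows from the maximum is caught under this
path and must, by the maximum principle, contain a positive pole; different maxima catch different
poles. Otherwise raising the level through \<open>c\<close> merges two components of the sublevel sets, and since
each component contains a negative pole or the far end of the axis, there are at most as many
mergers as negative poles. This is a Morse count (each critical point on the axis is a saddle of the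
doubled function), carried out with path components in place of nondegenerate critical points.

To reach critical points of every type, degenerate ones included, suppose that \<open>f\<close> has \<open>2 * N\<close> of them.
They leave \<open>2 * N + 1\<close> gaps, and since \<open>f\<close> is nowhere locally constant
(\<open>line_potential_not_locally_constant\<close>, by analytic continuation to the nearest complex singularity),
each gap contains a point where \<open>f'\<close> is nonzero. At \<open>N + 1\<close> of these points \<open>f'\<close> has the same sign, say
positive. For small \<open>e > 0\<close> the function \<open>f - e * x\<close> increases there and decreases at the next critical
point, or far out on the line, which gives \<open>N + 1\<close> separated maxima: one too many. These inequalities are
strict, so they survive moving charges on the line slightly off it, and this reduces the general case
to off-axis charges (\<open>card_descents_le_on_axis\<close>).\<close>

section \<open>A hypergeometric power series\<close>

text \<open>The coefficients of Gauss's hypergeometric series with parameters \<open>s / 2\<close>, \<open>(s + 1) / 2\<close> and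
\<open>s + 1 / 2\<close>. As the third parameter is the sum of the first two, the series has a logarithmic
singularity at 1.\<close>

definition ring_coeff :: "real \<Rightarrow> nat \<Rightarrow> real" where
  "ring_coeff s n =
     pochhammer (s / 2) n * pochhammer ((s + 1) / 2) n / (fact n * pochhammer (s + 1 / 2) n)"

lemma ring_coeff_0 [simp]: "ring_coeff s 0 = 1"
  by (simp add: ring_coeff_def)

lemma ring_coeff_pos:
  assumes "s > 0" shows "ring_coeff s n > 0"
  unfolding ring_coeff_def using assms
  by (intro divide_pos_pos mult_pos_pos pochhammer_pos) auto

lemma ring_coeff_Suc:
  assumes "s > 0"
  shows "(real n + 1) * (real n + s + 1/2) * ring_coeff s (Suc n)
       = (real n + s/2) * (real n + (s+1)/2) * ring_coeff s n"
proof -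
  have nz: "pochhammer (s + 1/2) n \<noteq> 0" 
    using pochhammer_pos[of "s+1/2" n] assms by linarith
  have "s + 1/2 + real n \<noteq> 0" using assms by linarith
  then show ?thesis using nz unfolding ring_coeff_def pochhammer_Suc fact_Suc of_nat_mult of_nat_Suc
    by (simp add: divide_simps) (simp add: algebra_simps)
qed

text \<open>The recursion makes \<open>n * ring_coeff s n\<close> nondecreasing. The series therefore diverges at 1, by comparison
with the harmonic series.\<close>

lemma ring_coeff_harmonic_bound:
  assumes "s > 0"
  shows "ring_coeff s 1 / real (Suc n) \<le> ring_coeff s (Suc n)"
proof (induction n)
  case (Suc n)
  have "real (Suc n) * (real (Suc n) + s + 1/2) \<le> (real (Suc n) + s/2) * (real (Suc n) + (s+1)/2)"
    using assms by (simp add: field_simps)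
  then have "real (Suc n) * (real (Suc n) + s + 1/2) * ring_coeff s (Suc n)
     \<le> (real (Suc n) + s/2) * (real (Suc n) + (s+1)/2) * ring_coeff s (Suc n)"
    using ring_coeff_pos[OF assms] by (intro mult_right_mono) (auto intro: less_imp_le)
  also have "\<dots> = (real (Suc n) + 1) * (real (Suc n) + s + 1/2) * ring_coeff s (Suc (Suc n))"
    using ring_coeff_Suc[OF assms, of "Suc n"] by simp
  finally have "(real (Suc n) + s + 1/2) * (real (Suc n) * ring_coeff s (Suc n))
     \<le> (real (Suc n) + s + 1/2) * (real (Suc (Suc n)) * ring_coeff s (Suc (Suc n)))"
    by (simp add: field_simps)
  then have "real (Suc n) * ring_coeff s (Suc n) \<le> real (Suc (Suc n)) * ring_coeff s (Suc (Suc n))"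
    by (rule mult_left_le_imp_le) (use assms in auto)
  with Suc show ?case by (simp add: field_simps)
qed simp

text \<open>By the recursion the coefficients are eventually nonincreasing, hence bounded.\<close>

lemma ring_coeff_summable:
  assumes "s > 0" "\<bar>q\<bar> < 1"
  shows "summable (\<lambda>n. ring_coeff s n * q ^ n)"
proof -
  define M where "M = nat \<lceil>s * (s + 1) / 4\<rceil>"
  have step: "ring_coeff s (Suc n) \<le> ring_coeff s n" if "n \<ge> M" for n
  proof -
    have "s * (s + 1) / 4 \<le> real n" using that unfolding M_def by linarith
    then have "(real n + s/2) * (real n + (s+1)/2) \<le> (real n + 1) * (real n + s + 1/2)"
      using assms(1) by (simp add: field_simps)
    then have "(real n + s/2) * (real n + (s+1)/2) * ring_coeff s n
       \<le> (real n + 1) * (real n + s + 1/2) * ring_coeff s n"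
      using ring_coeff_pos[OF assms(1)] by (intro mult_right_mono) (auto intro: less_imp_le)
    then have "(real n + 1) * (real n + s + 1/2) * ring_coeff s (Suc n)
       \<le> (real n + 1) * (real n + s + 1/2) * ring_coeff s n"
      using ring_coeff_Suc[OF assms(1), of n] by simp
    then show ?thesis by (rule mult_left_le_imp_le) (use assms in auto)
  qed
  have bd: "ring_coeff s (M + n) \<le> ring_coeff s M" for n
  proof (induction n)
    case (Suc n) then show ?case using step[of "M + n"] by simp
  qed simp
  have "summable (\<lambda>n. ring_coeff s (n + M) * q ^ (n + M))"
  proof (rule summable_comparison_test)
    show "summable (\<lambda>n. ring_coeff s M * (\<bar>q\<bar> ^ M * \<bar>q\<bar> ^ n))"
      by (intro summable_mult summable_geometric) (use assms in auto)
    show "\<exists>N. \<forall>n\<ge>N. norm (ring_coeff s (n + M) * q ^ (n + M)) \<le> ring_coeff s M * (\<bar>q\<bar> ^ M * \<bar>q\<bar> ^ n)"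
    proof (intro exI allI impI)
      fix n
      have "norm (ring_coeff s (n + M) * q ^ (n + M)) = ring_coeff s (M + n) * (\<bar>q\<bar> ^ M * \<bar>q\<bar> ^ n)"
        using ring_coeff_pos[OF assms(1), of "M + n"]
        by (simp add: abs_mult power_add power_abs ac_simps)
      also have "\<dots> \<le> ring_coeff s M * (\<bar>q\<bar> ^ M * \<bar>q\<bar> ^ n)"
        by (intro mult_right_mono bd) simp
      finally show "norm (ring_coeff s (n + M) * q ^ (n + M)) \<le> ring_coeff s M * (\<bar>q\<bar> ^ M * \<bar>q\<bar> ^ n)" .
    qed
  qed
  then show ?thesis using summable_iff_shift[of "\<lambda>n. ring_coeff s n * q ^ n" M] by blast
qed

definition ring_series :: "real \<Rightarrow> real \<Rightarrow> real" where
  "ring_series s q = (\<Sum>n. ring_coeff s n * q ^ n)"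
definition ring_series' :: "real \<Rightarrow> real \<Rightarrow> real" where
  "ring_series' s q = (\<Sum>n. diffs (ring_coeff s) n * q ^ n)"
definition ring_series'' :: "real \<Rightarrow> real \<Rightarrow> real" where
  "ring_series'' s q = (\<Sum>n. diffs (diffs (ring_coeff s)) n * q ^ n)"

lemma ring_series_0 [simp]: "ring_series s 0 = 1"
  unfolding ring_series_def by (subst powser_zero) simp

lemma summable_diffs_ring_coeff:
  assumes "s > 0" "\<bar>q\<bar> < 1"
  shows "summable (\<lambda>n. diffs (ring_coeff s) n * q ^ n)"
    and "summable (\<lambda>n. diffs (diffs (ring_coeff s)) n * q ^ n)"
proof -
  have 1: "summable (\<lambda>n. diffs (ring_coeff s) n * q ^ n)" if "norm q < 1" for q
    using termdiff_converges[of q 1 "ring_coeff s"] ring_coeff_summable[OF assms(1)] that by simp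
  show "summable (\<lambda>n. diffs (ring_coeff s) n * q ^ n)" using 1 assms by simp
  show "summable (\<lambda>n. diffs (diffs (ring_coeff s)) n * q ^ n)"
    using termdiff_converges[of q 1 "diffs (ring_coeff s)"] 1 assms by simp
qed

lemma DERIV_ring_series:
  assumes "s > 0" "\<bar>q\<bar> < 1"
  shows "(ring_series s has_real_derivative ring_series' s q) (at q)"
proof -
  obtain K where "\<bar>q\<bar> < K" "K < 1" using assms(2) dense by blast
  then show ?thesis unfolding ring_series_def[abs_def] ring_series'_def
    by (intro termdiffs_strong[of _ K]) (use ring_coeff_summable[OF assms(1), of K] in auto)
qed

lemma DERIV_ring_series':
  assumes "s > 0" "\<bar>q\<bar> < 1"
  shows "(ring_series' s has_real_derivative ring_series'' s q) (at q)"
proof -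
  obtain K where "\<bar>q\<bar> < K" "K < 1" using assms(2) dense by blast
  then show ?thesis unfolding ring_series'_def[abs_def] ring_series''_def
    by (intro termdiffs_strong[of _ K]) (use summable_diffs_ring_coeff(1)[OF assms(1), of K] in auto)
qed

lemma sums_drop_zero_head:
  fixes f :: "nat \<Rightarrow> 'a :: real_normed_vector"
  assumes "(\<lambda>n. f (Suc n)) sums l" "f 0 = 0"
  shows "f sums l"
  using sums_Suc[OF assms(1)] assms(2) by simp

text \<open>The hypergeometric equation, obtained by comparing coefficients with \<open>ring_coeff_Suc\<close>.\<close>

lemma ring_series_ODE:
  assumes "s > 0" "\<bar>q\<bar> < 1"
  shows "q * (1 - q) * ring_series'' s q + (s + 1/2 - (s + 3/2) * q) * ring_series' s q
       = s * (s + 1) / 4 * ring_series s q"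
proof -
  let ?c = "ring_coeff s"
  have H: "(\<lambda>n. ?c n * q ^ n) sums ring_series s q"
    unfolding ring_series_def by (rule summable_sums[OF ring_coeff_summable[OF assms]])
  have H1: "(\<lambda>n. (real n + 1) * ?c (Suc n) * q ^ n) sums ring_series' s q"
    using summable_sums[OF summable_diffs_ring_coeff(1)[OF assms]]
    unfolding ring_series'_def by (simp add: diffs_def algebra_simps)
  have "(\<lambda>n. (real n + 1) * (real n + 2) * ?c (Suc (Suc n)) * q ^ n) sums ring_series'' s q"
    using summable_sums[OF summable_diffs_ring_coeff(2)[OF assms]]
    unfolding ring_series''_def by (simp add: diffs_def algebra_simps)
  then have H2: "(\<lambda>n. q * ((real n + 1) * (real n + 2) * ?c (Suc (Suc n)) * q ^ n)) sums (q * ring_series'' s q)"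
    by (rule sums_mult)
  have qH2: "(\<lambda>n. real n * (real n + 1) * ?c (Suc n) * q ^ n) sums (q * ring_series'' s q)"
    by (rule sums_drop_zero_head) (use H2 in \<open>simp_all add: algebra_simps\<close>)
  have qqH2': "(\<lambda>n. q * (real n * (real n + 1) * ?c (Suc n) * q ^ n)) sums (q * (q * ring_series'' s q))"
    by (rule sums_mult[OF qH2])
  have qqH2: "(\<lambda>n. real n * (real n - 1) * ?c n * q ^ n) sums (q * (q * ring_series'' s q))"
    by (rule sums_drop_zero_head) (use qqH2' in \<open>simp_all add: algebra_simps\<close>)
  have qH1': "(\<lambda>n. q * ((real n + 1) * ?c (Suc n) * q ^ n)) sums (q * ring_series' s q)"
    by (rule sums_mult[OF H1])
  have qH1: "(\<lambda>n. real n * ?c n * q ^ n) sums (q * ring_series' s q)"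
    by (rule sums_drop_zero_head) (use qH1' in \<open>simp_all add: algebra_simps\<close>)
  have "(\<lambda>n. (real n * (real n + 1) * ?c (Suc n) * q ^ n - real n * (real n - 1) * ?c n * q ^ n)
     + ((s + 1/2) * ((real n + 1) * ?c (Suc n) * q ^ n) - (s + 3/2) * (real n * ?c n * q ^ n))
     - s * (s + 1) / 4 * (?c n * q ^ n))
   sums ((q * ring_series'' s q - q * (q * ring_series'' s q))
     + ((s + 1/2) * ring_series' s q - (s + 3/2) * (q * ring_series' s q))
     - s * (s + 1) / 4 * ring_series s q)"
    by (intro sums_add sums_diff sums_mult qH2 qqH2 H1 qH1 H)
  moreover have "(real n * (real n + 1) * ?c (Suc n) * q ^ n - real n * (real n - 1) * ?c n * q ^ n)
     + ((s + 1/2) * ((real n + 1) * ?c (Suc n) * q ^ n) - (s + 3/2) * (real n * ?c n * q ^ n))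
     - s * (s + 1) / 4 * (?c n * q ^ n) = 0" (is "?lhs = 0") for n
  proof -
    have "?lhs = ((real n + 1) * (real n + s + 1/2) * ?c (Suc n)
      - (real n + s/2) * (real n + (s+1)/2) * ?c n) * q ^ n" by (simp add: field_simps)
    then show ?thesis using ring_coeff_Suc[OF assms(1), of n] by simp
  qed
  ultimately have "(\<lambda>n. 0) sums ((q * ring_series'' s q - q * (q * ring_series'' s q))
     + ((s + 1/2) * ring_series' s q - (s + 3/2) * (q * ring_series' s q))
     - s * (s + 1) / 4 * ring_series s q)" by (simp only:)
  then show ?thesis using sums_unique2[OF _ sums_zero] by (fastforce simp: algebra_simps)
qed

lemma ring_series_mono:
  assumes "s > 0" "0 \<le> q" "q \<le> q'" "q' < 1"
  shows "ring_series s q \<le> ring_series s q'"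
  unfolding ring_series_def
  by (intro suminf_le mult_left_mono power_mono ring_coeff_summable)
     (use assms ring_coeff_pos in \<open>auto intro: less_imp_le\<close>)

lemma ring_series_ge_1:
  assumes "s > 0" "0 \<le> q" "q < 1"
  shows "1 \<le> ring_series s q"
  using ring_series_mono[of s 0 q] assms by simp

text \<open>Every partial sum is continuous at 1, and the partial sums at 1 are unbounded.\<close>

lemma ring_series_at_top:
  assumes "s > 0"
  shows "filterlim (ring_series s) at_top (at_left 1)"
proof (rule filterlim_at_top[THEN iffD2], intro allI)
  fix Z
  have "\<not> summable (\<lambda>n. ring_coeff s (Suc n))"
  proof
    assume "summable (\<lambda>n. ring_coeff s (Suc n))"
    then have "summable (\<lambda>n. ring_coeff s 1 / real (Suc n))"
      by (rule summable_comparison_test[rotated])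
         (use ring_coeff_harmonic_bound[OF assms] ring_coeff_pos[OF assms] in \<open>auto intro!: exI[of _ 0] simp: less_imp_le abs_of_pos\<close>)
    then have "summable (\<lambda>n. ring_coeff s 1 * inverse (real (Suc n)))" by (simp add: divide_inverse)
    moreover have "ring_coeff s 1 \<noteq> 0" using ring_coeff_pos[OF assms, of 1] by linarith
    ultimately have "summable (\<lambda>n. inverse (real (Suc n)))" by (simp only: summable_cmult_iff) auto
    then show False using not_summable_harmonic[where 'a = real]
      using summable_Suc_iff[of "\<lambda>n. inverse (real n)"] by (simp add: inverse_eq_divide)
  qed
  then have "\<not> (\<forall>n. (\<Sum>k<n. ring_coeff s k) \<le> Z)"
    using summableI_nonneg_bounded[of "ring_coeff s" Z] ring_coeff_pos[OF assms]
      summable_Suc_iff[of "ring_coeff s"]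
    by (metis less_imp_le)
  then obtain n where n: "(\<Sum>k<n. ring_coeff s k * 1 ^ k) > Z"
    by (auto simp: not_le)
  have "((\<lambda>q. \<Sum>k<n. ring_coeff s k * q ^ k) \<longlongrightarrow> (\<Sum>k<n. ring_coeff s k * 1 ^ k)) (at_left 1)"
    by (intro tendsto_intros)
  then have "\<forall>\<^sub>F q in at_left 1. Z < (\<Sum>k<n. ring_coeff s k * q ^ k)"
    using n by (rule order_tendstoD)
  moreover have "\<forall>\<^sub>F q in at_left (1::real). 0 < q \<and> q < 1"
    by (rule eventually_at_leftI[of 0]) auto
  ultimately show "\<forall>\<^sub>F q in at_left 1. Z \<le> ring_series s q"
  proof eventually_elim
    case (elim q)
    then have "(\<Sum>k<n. ring_coeff s k * q ^ k) \<le> ring_series s q"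
      unfolding ring_series_def
      by (intro sum_le_suminf ring_coeff_summable) (use assms ring_coeff_pos[OF assms] in \<open>auto intro!: mult_nonneg_nonneg less_imp_le\<close>)
    with elim show ?case by simp
  qed
qed

section \<open>The extension of a single charge to the half plane\<close>

text \<open>For \<open>s = 1 / 2\<close> this is, up to a constant factor, the potential of a uniformly charged ring in space, and for
integral \<open>2 * s\<close> that of a charged sphere of dimension \<open>2 * s\<close> in dimension \<open>2 * s + 2\<close>, written with the squared
distance from the axis as the second coordinate \<open>y\<close>. In this coordinate the function stays smooth across the axis \<open>y = 0\<close>, where it reduces
to the kernel of the restricted potential.\<close>

definition ring_kernel :: "real \<Rightarrow> real \<Rightarrow> real \<Rightarrow> real \<Rightarrow> real \<Rightarrow> real" where
  "ring_kernel s a b x y =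
     ((x - a)\<^sup>2 + y + b\<^sup>2) powr - s * ring_series s (4 * y * b\<^sup>2 / ((x - a)\<^sup>2 + y + b\<^sup>2)\<^sup>2)"

text \<open>The letters \<open>R\<close> and \<open>q\<close> are the two quantities from which the kernel is built; \<open>kx\<close>, \<open>kxx\<close>, \<open>ky\<close> and \<open>kyy\<close> are
its first and second partial derivatives in closed form.\<close>

locale ring_point =
  fixes s a b :: real
  assumes s: "s > 0" and b: "b > 0"
begin

definition R where "R x y = (x - a)\<^sup>2 + y + b\<^sup>2"
definition q where "q x y = 4 * y * b\<^sup>2 / (R x y)\<^sup>2"
definition G where "G x y = s * ring_series s (q x y) + 2 * q x y * ring_series' s (q x y)"
definition G' where "G' x y = (s + 2) * ring_series' s (q x y) + 2 * q x y * ring_series'' s (q x y)"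
definition kx where "kx x y = - 2 * (x - a) * R x y powr (- s - 1) * G x y"
definition kxx where "kxx x y = - 2 * R x y powr (- s - 1) * G x y
  + 4 * (s + 1) * (x - a)\<^sup>2 * R x y powr (- s - 2) * G x y
  + 8 * (x - a)\<^sup>2 * q x y * R x y powr (- s - 2) * G' x y"
definition qy where "qy x y = 4 * b\<^sup>2 / (R x y)\<^sup>2 - 2 * q x y / R x y"
definition ky where "ky x y = 4 * b\<^sup>2 * R x y powr (- s - 2) * ring_series' s (q x y)
  - R x y powr (- s - 1) * G x y"
definition kyy where "kyy x y = (s + 1) * R x y powr (- s - 2) * G x y
  - R x y powr (- s - 1) * G' x y * qy x y
  - 4 * b\<^sup>2 * (s + 2) * R x y powr (- s - 3) * ring_series' s (q x y)
  + 4 * b\<^sup>2 * R x y powr (- s - 2) * ring_series'' s (q x y) * qy x y"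

lemma kernel_eq: "ring_kernel s a b x y = R x y powr - s * ring_series s (q x y)"
  by (simp add: ring_kernel_def R_def q_def)

text \<open>The gap \<open>R\<^sup>2 - 4 * y * b\<^sup>2\<close> is a sum of nonnegative terms that vanishes only at the ring itself, so the
series is evaluated inside its disc of convergence everywhere else.\<close>

lemma regular:
  assumes "y \<ge> 0" "(x, y) \<noteq> (a, b\<^sup>2)"
  shows "R x y > 0" "0 \<le> q x y" "q x y < 1"
proof -
  show R: "R x y > 0" using assms(1) b unfolding R_def by (simp add: add_nonneg_pos)
  then show "0 \<le> q x y" using assms(1) unfolding q_def by simp
  have "(R x y)\<^sup>2 - 4 * y * b\<^sup>2 = (y - b\<^sup>2)\<^sup>2 + (x - a)\<^sup>2 * ((x - a)\<^sup>2 + 2 * y + 2 * b\<^sup>2)"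
    unfolding R_def by (simp add: power2_eq_square algebra_simps)
  moreover have "\<dots> > 0"
  proof (cases "x = a")
    case True
    then show ?thesis using assms(2) by simp
  next
    case False
    then have "0 < (x - a)\<^sup>2 * ((x - a)\<^sup>2 + 2 * y + 2 * b\<^sup>2)"
      using assms(1) b by (intro mult_pos_pos) (auto simp: add_nonneg_pos)
    then show ?thesis by (simp add: add_nonneg_pos)
  qed
  ultimately show "q x y < 1" using R unfolding q_def by simp
qed

lemma DERIV_kernel_x:
  assumes "R x y > 0" "\<bar>q x y\<bar> < 1"
  shows "((\<lambda>x. ring_kernel s a b x y) has_real_derivative kx x y) (at x)"
    and "((\<lambda>x. kx x y) has_real_derivative kxx x y) (at x)"
proof -
  note R = assms(1)
  have dR: "((\<lambda>x. R x y) has_real_derivative 2 * (x - a)) (at x)"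
    unfolding R_def by (auto intro!: derivative_eq_intros)
  have dP: "((\<lambda>x. R x y powr t) has_real_derivative t * R x y powr (t - 1) * (2 * (x - a))) (at x)" for t
    by (rule DERIV_chain2[OF has_real_derivative_powr[OF R] dR])
  have dq: "((\<lambda>x. q x y) has_real_derivative - 4 * (x - a) * q x y / R x y) (at x)"
    unfolding q_def using R by (auto intro!: derivative_eq_intros dR simp: field_simps power2_eq_square)
  have dH: "((\<lambda>x. ring_series s (q x y)) has_real_derivative ring_series' s (q x y) * (- 4 * (x - a) * q x y / R x y)) (at x)"
    by (rule DERIV_chain2[OF DERIV_ring_series[OF s assms(2)] dq])
  have dH': "((\<lambda>x. ring_series' s (q x y)) has_real_derivative ring_series'' s (q x y) * (- 4 * (x - a) * q x y / R x y)) (at x)"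
    by (rule DERIV_chain2[OF DERIV_ring_series'[OF s assms(2)] dq])
  have p1: "R x y powr (- s - 1) = R x y powr - s / R x y"
    and p2: "R x y powr (- s - 2) = R x y powr - s / (R x y)\<^sup>2"
    using R by (simp_all add: powr_diff)
  have dG: "((\<lambda>x. G x y) has_real_derivative G' x y * (- 4 * (x - a) * q x y / R x y)) (at x)"
    unfolding G_def G'_def
    by (auto intro!: derivative_eq_intros dH dH' dq simp: algebra_simps add_divide_distrib diff_divide_distrib)
  show "((\<lambda>x. ring_kernel s a b x y) has_real_derivative kx x y) (at x)"
    unfolding kernel_eq kx_def G_def
    by (rule derivative_eq_intros dP dH)+ (use R in \<open>simp add: p1 field_simps\<close>)
  show "((\<lambda>x. kx x y) has_real_derivative kxx x y) (at x)"
    unfolding kx_def kxx_def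
    by (rule derivative_eq_intros dP dG refl)+ (use R in \<open>simp add: p1 p2 field_simps power2_eq_square\<close>)
qed

lemma DERIV_kernel_y:
  assumes "R x y > 0" "\<bar>q x y\<bar> < 1"
  shows "((\<lambda>y. ring_kernel s a b x y) has_real_derivative ky x y) (at y)"
    and "((\<lambda>y. ky x y) has_real_derivative kyy x y) (at y)"
proof -
  note R = assms(1)
  have dR: "((\<lambda>y. R x y) has_real_derivative 1) (at y)"
    unfolding R_def by (auto intro!: derivative_eq_intros)
  have dP: "((\<lambda>y. R x y powr t) has_real_derivative t * R x y powr (t - 1) * 1) (at y)" for t
    by (rule DERIV_chain2[OF has_real_derivative_powr[OF R] dR])
  have dq: "((\<lambda>y. q x y) has_real_derivative qy x y) (at y)"
    unfolding q_def qy_def using R by (auto intro!: derivative_eq_intros dR simp: field_simps power2_eq_square)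
  have dH: "((\<lambda>y. ring_series s (q x y)) has_real_derivative ring_series' s (q x y) * qy x y) (at y)"
    by (rule DERIV_chain2[OF DERIV_ring_series[OF s assms(2)] dq])
  have dH': "((\<lambda>y. ring_series' s (q x y)) has_real_derivative ring_series'' s (q x y) * qy x y) (at y)"
    by (rule DERIV_chain2[OF DERIV_ring_series'[OF s assms(2)] dq])
  have p1: "R x y powr (- s - 1) = R x y powr - s / R x y"
    and p2: "R x y powr (- s - 2) = R x y powr - s / (R x y)\<^sup>2"
    and p3: "R x y powr (- s - 3) = R x y powr - s / (R x y)^3"
    using R by (simp_all add: powr_diff)
  have dG: "((\<lambda>y. G x y) has_real_derivative G' x y * qy x y) (at y)"
    unfolding G_def G'_def
    by (auto intro!: derivative_eq_intros dH dH' dq simp: algebra_simps add_divide_distrib diff_divide_distrib)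
  show "((\<lambda>y. ring_kernel s a b x y) has_real_derivative ky x y) (at y)"
    unfolding kernel_eq ky_def G_def
    by (rule derivative_eq_intros dP dH)+ (use R in \<open>simp add: qy_def p1 p2 field_simps power2_eq_square\<close>)
  show "((\<lambda>y. ky x y) has_real_derivative kyy x y) (at y)"
    unfolding ky_def kyy_def
    by (rule derivative_eq_intros dP dG dH' refl)+ (use R in \<open>simp add: p1 p2 p3 field_simps power2_eq_square\<close>)
qed

text \<open>After the substitution of the partial derivatives, the left-hand side is a multiple of the
hypergeometric equation at \<open>q x y\<close>.\<close>

lemma kernel_PDE:
  assumes "R x y > 0" "\<bar>q x y\<bar> < 1"
  shows "kxx x y + 4 * y * kyy x y + 2 * (1 + 2 * s) * ky x y = 0"
proof -
  define h h1 h2 r where "h = ring_series s (q x y)" and "h1 = ring_series' s (q x y)"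
    and "h2 = ring_series'' s (q x y)" and "r = inverse (R x y)"
  have rR: "r * R x y = 1" using assms(1) unfolding r_def by simp
  have q: "q x y = 4 * y * b\<^sup>2 * r\<^sup>2"
    unfolding q_def r_def by (simp add: divide_inverse power_inverse)
  have p: "R x y powr (- s - 1) = R x y powr - s * r"
       "R x y powr (- s - 2) = R x y powr - s * r\<^sup>2"
       "R x y powr (- s - 3) = R x y powr - s * r ^ 3"
    using assms(1) by (simp_all add: powr_diff r_def divide_inverse power_inverse)
  have ode: "q x y * (1 - q x y) * h2 + (s + 1/2 - (s + 3/2) * q x y) * h1 = s * (s + 1) / 4 * h"
    unfolding h_def h1_def h2_def by (rule ring_series_ODE[OF s assms(2)])
  define X Y where "X = (x - a)\<^sup>2" and "Y = R x y"
  have X: "X = Y - y - b\<^sup>2" unfolding X_def Y_def R_def by simp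
  have qy: "qy x y = 4 * b\<^sup>2 * r\<^sup>2 - 2 * q x y * r"
    unfolding qy_def r_def by (simp add: divide_inverse power_inverse)
  have "kxx x y + 4 * y * kyy x y + 2 * (1 + 2 * s) * ky x y
     = R x y powr - s * (16 * b\<^sup>2 * r\<^sup>2) * 
      (q x y * (1 - q x y) * h2 + (s + 1/2 - (s + 3/2) * q x y) * h1 - s * (s + 1) / 4 * h)"
    unfolding kxx_def kyy_def ky_def G_def G'_def p qy h_def[symmetric] h1_def[symmetric] h2_def[symmetric]
     X_def[symmetric] X
    unfolding q
    using rR[folded Y_def]
    by algebra
  then show ?thesis using ode by simp
qed

end

section \<open>Planar topology of the closed half plane\<close>

definition upper_half :: "(real \<times> real) set" where
  "upper_half = {z. 0 \<le> snd z}"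

lemma closed_upper_half: "closed upper_half"
  unfolding upper_half_def by (intro closed_Collect_le continuous_intros)

lemma convex_upper_half: "convex upper_half"
  unfolding upper_half_def convex_alt by (auto intro!: add_nonneg_nonneg)

lemma convex_path_component:
  fixes A :: "'a :: real_normed_vector set"
  assumes "convex A" "A \<subseteq> S" "x \<in> A" "y \<in> A"
  shows "path_component S x y"
  using assms path_component_of_subset path_connected_component convex_imp_path_connected by metis

text \<open>This is the interlacing form of Fashoda's theorem, moved from \<open>real ^ 2\<close> to pairs and to the half plane.\<close>

lemma paths_interlace:
  fixes f g :: "real \<Rightarrow> real \<times> real"
  assumes "path f" "path g" "path_image f \<subseteq> upper_half" "path_image g \<subseteq> upper_half"
    and ends: "pathstart f = (x1, 0)" "pathfinish f = (x3, 0)" "pathstart g = (x2, 0)" "pathfinish g = (x4, 0)"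
    and order: "x1 < x2" "x2 < x3" "x3 < x4"
  shows "path_image f \<inter> path_image g \<noteq> {}"
proof -
  define \<phi> :: "real \<times> real \<Rightarrow> real ^ 2" where "\<phi> z = (\<chi> i. if i = 1 then fst z else snd z)" for z
  have phi: "\<phi> z $ 1 = fst z" "\<phi> z $ 2 = snd z" for z by (simp_all add: \<phi>_def)
  have cont: "continuous_on A \<phi>" for A
  proof -
    have "continuous_on A (\<lambda>z. if i = (1::2) then fst z else snd z)" for i
      by (cases "i = 1") (auto intro!: continuous_intros)
    then show ?thesis unfolding \<phi>_def by (intro continuous_on_vec_lambda)
  qed
  have "bounded (path_image f \<union> path_image g)"
    using assms(1,2) by (simp add: bounded_path_image)
  then obtain B where B: "\<And>z. z \<in> path_image f \<union> path_image g \<Longrightarrow> norm z \<le> B"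
    by (auto simp: bounded_iff)
  have box: "\<phi> z \<in> cbox (\<phi> (- B, 0)) (\<phi> (B, B))" if "z \<in> path_image f \<union> path_image g" for z
  proof -
    have "\<bar>fst z\<bar> \<le> B" "\<bar>snd z\<bar> \<le> B"
      using B[OF that] norm_fst_le[of "fst z" "snd z"] norm_snd_le[of "snd z" "fst z"] by auto
    moreover have "0 \<le> snd z" using that assms(3,4) by (auto simp: upper_half_def)
    ultimately show ?thesis by (auto simp: mem_box_cart phi forall_2)
  qed
  obtain z where "z \<in> path_image (\<phi> \<circ> f)" "z \<in> path_image (\<phi> \<circ> g)"
  proof (rule fashoda_interlace[of "\<phi> \<circ> f" "\<phi> \<circ> g" "\<phi> (- B, 0)" "\<phi> (B, B)"])
    show "path (\<phi> \<circ> f)" "path (\<phi> \<circ> g)"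
      using assms(1,2) cont by (auto intro: path_continuous_image)
  qed (use box ends order in \<open>auto simp: path_image_compose pathstart_compose pathfinish_compose phi\<close>)
  then obtain u v where "u \<in> path_image f" "v \<in> path_image g" "\<phi> u = \<phi> v"
    unfolding path_image_compose by force
  then have "u = v" using phi by (metis prod_eq_iff)
  then show ?thesis using \<open>u \<in> path_image f\<close> \<open>v \<in> path_image g\<close> by blast
qed

text \<open>A path of \<open>S\<close> over the interval \<open>(l, r)\<close> is a barrier: if a component of \<open>U\<close> meets the axis below the
barrier, then it meets the axis only there, as paths with interlacing ends cross.\<close>

lemma trapped_path_component:
  assumes S: "path_component S (l, 0) (r, 0)" and U: "path_component U (q, 0) (t, 0)"
    and "S \<inter> U = {}" "S \<subseteq> upper_half" "U \<subseteq> upper_half" and q: "l < q" "q < r"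
  shows "l < t \<and> t < r"
proof -
  obtain f where f: "path f" "path_image f \<subseteq> S" "pathstart f = (l, 0)" "pathfinish f = (r, 0)"
    using S by (auto simp: path_component_def)
  obtain g where g: "path g" "path_image g \<subseteq> U" "pathstart g = (q, 0)" "pathfinish g = (t, 0)"
    using U by (auto simp: path_component_def)
  have disj: "path_image f \<inter> path_image g = {}" using f g assms(3) by blast
  have fg: "path_image f \<subseteq> upper_half" "path_image g \<subseteq> upper_half"
    using f(2) g(2) assms(4,5) by blast+
  have "t \<noteq> l" "t \<noteq> r"
    using disj f g pathstart_in_path_image pathfinish_in_path_image by (metis disjoint_iff)+
  moreover have "\<not> r < t"
    using paths_interlace[of f g l r q t] f g fg disj q by auto
  moreover have "\<not> t < l"
    using paths_interlace[of "reversepath g" f t q l r] f g fg disj q by auto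
  ultimately show ?thesis by linarith
qed

section \<open>Counting mergers of classes\<close>

text \<open>The relations \<open>E t\<close> are equivalence relations on \<open>T\<close> that get coarser with the level \<open>t\<close>. When the level passes
\<open>c i\<close>, the classes of \<open>a i\<close> and \<open>b i\<close> merge and the number of classes drops; it starts at most at
\<open>card T\<close> and never falls below 1. Distinct levels make sure that no drop is counted twice.\<close>

lemma card_merges_less:
  fixes E :: "real \<Rightarrow> 'a \<Rightarrow> 'a \<Rightarrow> bool" and c :: "'i \<Rightarrow> real"
  assumes "finite T" "T \<noteq> {}" "finite I" "inj_on c I" and t0: "\<And>i. i \<in> I \<Longrightarrow> t0 \<le> c i"
    and refl: "\<And>t x. t0 \<le> t \<Longrightarrow> x \<in> T \<Longrightarrow> E t x x"
    and sym: "\<And>t x y. E t x y \<Longrightarrow> E t y x"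
    and trans: "\<And>t x y z. E t x y \<Longrightarrow> E t y z \<Longrightarrow> E t x z"
    and mono: "\<And>t t' x y. t \<le> t' \<Longrightarrow> E t x y \<Longrightarrow> E t' x y"
    and ab: "\<And>i. i \<in> I \<Longrightarrow> a i \<in> T" "\<And>i. i \<in> I \<Longrightarrow> b i \<in> T"
    and apart: "\<And>i. i \<in> I \<Longrightarrow> \<not> E (c i) (a i) (b i)"
    and merged: "\<And>i t. i \<in> I \<Longrightarrow> c i < t \<Longrightarrow> E t (a i) (b i)"
  shows "card I < card T"
proof -
  define cls where "cls t x = {y \<in> T. E t x y}" for t x
  have cls_eq: "cls t x = cls t y \<longleftrightarrow> E t x y" if "t0 \<le> t" "x \<in> T" "y \<in> T" for t x y
  proof
    assume "cls t x = cls t y"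
    then have "y \<in> cls t x" using refl[OF that(1,3)] that(3) by (simp add: cls_def)
    then show "E t x y" by (simp add: cls_def)
  next
    assume "E t x y"
    then have "E t x z \<longleftrightarrow> E t y z" for z using sym trans by metis
    then show "cls t x = cls t y" by (simp add: cls_def)
  qed
  have "\<forall>t. (\<forall>i\<in>J. c i < t) \<longrightarrow> t0 \<le> t \<longrightarrow> card J + card (cls t ` T) \<le> card T"
    if "finite J" "J \<subseteq> I" for J
    using that
  proof (induction J rule: finite_ranking_induct[where f = c])
    case empty
    then show ?case using card_image_le[OF assms(1)] by auto
  next
    case (insert j J)
    show ?case
    proof (cases "j \<in> J")
      case True
      then show ?thesis using insert by (simp add: insert_absorb)
    next
      case False
      show ?thesis
      proof (intro allI impI)
        fix t assume t: "\<forall>i\<in>insert j J. c i < t" "t0 \<le> t"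
        have j: "j \<in> I" "c j < t" "t0 \<le> c j" using insert t t0 by auto
        have "c i < c j" if "i \<in> J" for i
        proof -
          have "c i \<noteq> c j" using inj_onD[OF assms(4)] that False insert.prems by blast
          then show ?thesis using insert.hyps(2)[OF that] by linarith
        qed
        then have IH: "card J + card (cls (c j) ` T) \<le> card T"
          using insert.IH insert.prems j by blast
        \<comment> \<open>The map \<open>up\<close> sends a class at level \<open>c j\<close> to the class at level \<open>t\<close> that contains it.\<close>
        define up where "up X = (\<Union>x\<in>X. cls t x)" for X
        have up: "up (cls (c j) x) = cls t x" if "x \<in> T" for x
        proof -
          have "cls t y = cls t x" if "y \<in> cls (c j) x" for y
            using that cls_eq[OF t(2)] \<open>x \<in> T\<close> mono[of "c j" t] j sym unfolding cls_def by auto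
          moreover have "x \<in> cls (c j) x" using that refl j by (auto simp: cls_def)
          ultimately show ?thesis unfolding up_def by blast
        qed
        have img: "cls t ` T = up ` (cls (c j) ` T)"
          unfolding image_image using up by (intro image_cong) auto
        have "\<not> inj_on up (cls (c j) ` T)"
        proof
          assume "inj_on up (cls (c j) ` T)"
          moreover have "up (cls (c j) (a j)) = up (cls (c j) (b j))"
            using up ab[OF j(1)] cls_eq[OF t(2)] merged[OF j(1,2)] by auto
          ultimately have "cls (c j) (a j) = cls (c j) (b j)"
            using ab[OF j(1)] by (auto dest: inj_onD)
          then show False using apart[OF j(1)] cls_eq[OF j(3)] ab[OF j(1)] by blast
        qed
        then have "card (cls t ` T) \<noteq> card (cls (c j) ` T)"
          unfolding img using eq_card_imp_inj_on assms(1) by blast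
        moreover have "card (cls t ` T) \<le> card (cls (c j) ` T)"
          unfolding img by (intro card_image_le) (use assms(1) in simp)
        ultimately show "card (insert j J) + card (cls t ` T) \<le> card T"
          using IH False insert.hyps(1) by simp
      qed
    qed
  qed
  from this[OF assms(3) order_refl] have *: "card I + card (cls t ` T) \<le> card T"
    if "\<forall>i\<in>I. c i < t" "t0 \<le> t" for t
    using that by blast
  define t where "t = Max (insert t0 (c ` I)) + 1"
  have "x < t" if "x \<in> insert t0 (c ` I)" for x
  proof -
    have "x \<le> Max (insert t0 (c ` I))" by (rule Max_ge[OF _ that]) (use assms(3) in simp)
    then show ?thesis unfolding t_def by linarith
  qed
  then have "card I + card (cls t ` T) \<le> card T" by (intro *) (auto intro: less_imp_le)
  moreover have "card (cls t ` T) > 0" using assms(1,2) by (simp add: card_gt_0_iff)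
  ultimately show ?thesis by linarith
qed

section \<open>Saddle-type functions with finitely many poles\<close>

text \<open>The value of \<open>w\<close> at a pole carries no meaning, so poles are put into the sublevel sets by hand: negative
ones belong to all of them, positive ones to none.\<close>

definition sublevel :: "(real \<times> real \<Rightarrow> real) \<Rightarrow> (real \<times> real) set \<Rightarrow> (real \<times> real) set \<Rightarrow> real \<Rightarrow> (real \<times> real) set" where
  "sublevel w Pos Neg c = {z \<in> upper_half. z \<in> Neg \<or> z \<notin> Pos \<and> w z < c}"

lemma sublevel_mono: "c \<le> c' \<Longrightarrow> sublevel w Pos Neg c \<subseteq> sublevel w Pos Neg c'"
  by (auto simp: sublevel_def)

lemma sublevel_upper_half: "sublevel w Pos Neg c \<subseteq> upper_half"
  by (auto simp: sublevel_def)

text \<open>Saddle-type behaviour is stated as a perturbed maximum principle: neither \<open>w - \<delta> * x\<^sup>2\<close> has a local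
minimum nor \<open>w + \<delta> * x\<^sup>2\<close> a local maximum, on the axis as well as off it. This is the form that follows from
the second derivative test, since \<open>x\<^sup>2\<close> is a strict subsolution. The tilt \<open>e\<close> turns infinity into two
far ends of the axis, one low and one high.\<close>

locale charged_half_plane =
  fixes w :: "real \<times> real \<Rightarrow> real" and Pos Neg :: "(real \<times> real) set" and e :: real
  assumes finite_charges: "finite Pos" "finite Neg"
    and disjoint_charges: "Pos \<inter> Neg = {}"
    and charges_inside: "\<And>z. z \<in> Pos \<union> Neg \<Longrightarrow> 0 < snd z"
    and tilt: "e \<noteq> 0"
    and continuous: "\<And>z. z \<in> upper_half - (Pos \<union> Neg) \<Longrightarrow> continuous (at z within upper_half) w"
    and at_Pos: "\<And>z. z \<in> Pos \<Longrightarrow> filterlim w at_top (at z within upper_half)"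
    and at_Neg: "\<And>z. z \<in> Neg \<Longrightarrow> filterlim w at_bot (at z within upper_half)"
    and no_min: "\<And>z \<delta> \<rho>. z \<in> upper_half - (Pos \<union> Neg) \<Longrightarrow> 0 < \<delta> \<Longrightarrow> 0 < \<rho> \<Longrightarrow>
      \<exists>y \<in> ball z \<rho> \<inter> upper_half. w y - \<delta> * (fst y)\<^sup>2 < w z - \<delta> * (fst z)\<^sup>2"
    and no_max: "\<And>z \<delta> \<rho>. z \<in> upper_half - (Pos \<union> Neg) \<Longrightarrow> 0 < \<delta> \<Longrightarrow> 0 < \<rho> \<Longrightarrow>
      \<exists>y \<in> ball z \<rho> \<inter> upper_half. w z + \<delta> * (fst z)\<^sup>2 < w y + \<delta> * (fst y)\<^sup>2"
    and far: "\<And>\<delta>. 0 < \<delta> \<Longrightarrow>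
      \<exists>\<rho>. \<forall>z\<in>upper_half. \<rho> < \<bar>fst z\<bar> \<or> \<rho> < snd z \<longrightarrow> \<bar>w z + e * fst z\<bar> < \<delta>"
begin

text \<open>The assumptions are invariant under \<open>w \<mapsto> - w\<close> with the poles exchanged, so statements about sublevel
sets carry over to superlevel sets.\<close>

lemma negate: "charged_half_plane (\<lambda>z. - w z) Neg Pos (- e)"
proof unfold_locales
  show "filterlim (\<lambda>z. - w z) at_top (at z within upper_half)" if "z \<in> Neg" for z
    using at_Neg[OF that] by (simp add: filterlim_uminus_at_bot)
  show "filterlim (\<lambda>z. - w z) at_bot (at z within upper_half)" if "z \<in> Pos" for z
    using at_Pos[OF that] by (simp add: filterlim_uminus_at_top)
  show "\<exists>\<rho>. \<forall>z\<in>upper_half. \<rho> < \<bar>fst z\<bar> \<or> \<rho> < snd z \<longrightarrow> \<bar>- w z + - e * fst z\<bar> < \<delta>"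
    if "0 < \<delta>" for \<delta>
  proof -
    have "\<bar>- w z + - e * fst z\<bar> = \<bar>w z + e * fst z\<bar>" for z
      by (subst abs_minus_cancel[symmetric]) simp
    then show ?thesis using far[OF that] by simp
  qed
  show "continuous (at z within upper_half) (\<lambda>z. - w z)" if "z \<in> upper_half - (Neg \<union> Pos)" for z
    using continuous[of z] that by (intro continuous_intros) auto
  fix \<delta> \<rho> :: real and y assume *: "0 < \<delta>" "0 < \<rho>" "y \<in> upper_half - (Neg \<union> Pos)"
  then have y: "y \<in> upper_half - (Pos \<union> Neg)" by blast
  show "\<exists>z\<in>ball y \<rho> \<inter> upper_half. - w z - \<delta> * (fst z)\<^sup>2 < - w y - \<delta> * (fst y)\<^sup>2"
  proof -
    obtain z where "z \<in> ball y \<rho> \<inter> upper_half" "w y + \<delta> * (fst y)\<^sup>2 < w z + \<delta> * (fst z)\<^sup>2"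
      using no_max[OF y *(1,2)] by blast
    then show ?thesis by (intro bexI[of _ z]) linarith+
  qed
  show "\<exists>z\<in>ball y \<rho> \<inter> upper_half. - w y + \<delta> * (fst y)\<^sup>2 < - w z + \<delta> * (fst z)\<^sup>2"
  proof -
    obtain z where "z \<in> ball y \<rho> \<inter> upper_half" "w z - \<delta> * (fst z)\<^sup>2 < w y - \<delta> * (fst y)\<^sup>2"
      using no_min[OF y *(1,2)] by blast
    then show ?thesis by (intro bexI[of _ z]) linarith+
  qed
qed (use finite_charges disjoint_charges charges_inside tilt in auto)

abbreviation below :: "real \<Rightarrow> (real \<times> real) set" where
  "below \<equiv> sublevel w Pos Neg"
abbreviation above :: "real \<Rightarrow> (real \<times> real) set" where
  "above c \<equiv> sublevel (\<lambda>z. - w z) Neg Pos (- c)"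

lemma below_above_disjoint: "c \<le> c' \<Longrightarrow> below c \<inter> above c' = {}"
  using disjoint_charges by (auto simp: sublevel_def)

lemma below_axis: "(x, 0) \<in> below c \<longleftrightarrow> w (x, 0) < c"
  and above_axis: "(x, 0) \<in> above c \<longleftrightarrow> c < w (x, 0)"
  using charges_inside[of "(x, 0)"] by (auto simp: sublevel_def upper_half_def)

text \<open>Half discs are convex, so that path components are relatively open. In particular a pole is joined to its
surroundings.\<close>

lemma below_open:
  assumes "z \<in> below c"
  obtains \<rho> where "\<rho> > 0" "ball z \<rho> \<inter> upper_half \<subseteq> below c"
    "\<And>y. y \<in> ball z \<rho> \<inter> upper_half \<Longrightarrow> path_component (below c) z y"
proof -
  have zH: "z \<in> upper_half" using assms by (simp add: sublevel_def)
  have "\<forall>\<^sub>F y in at z within upper_half. w y < c"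
  proof (cases "z \<in> Neg")
    case True
    then show ?thesis using at_Neg by (auto simp: filterlim_at_bot_dense)
  next
    case False
    then have "w z < c" "z \<in> upper_half - (Pos \<union> Neg)" using assms by (auto simp: sublevel_def)
    then show ?thesis using continuous[of z] order_tendstoD(2)[of w "w z"] unfolding continuous_within by blast
  qed
  moreover have "\<forall>\<^sub>F y in at z within upper_half. y \<notin> Pos - {z}"
  proof -
    have "open (- (Pos - {z}))" by (intro open_Compl finite_imp_closed) (use finite_charges in simp)
    then have "\<forall>\<^sub>F y in nhds z. y \<in> - (Pos - {z})" by (intro eventually_nhds_in_open) auto
    then show ?thesis unfolding eventually_at_filter by (auto elim: eventually_mono)
  qed
  ultimately have "\<forall>\<^sub>F y in at z within upper_half. y \<in> upper_half \<longrightarrow> y \<in> below c"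
    unfolding eventually_at_filter by eventually_elim (auto simp: sublevel_def)
  then obtain \<rho> where r: "\<rho> > 0" "\<And>y. y \<in> upper_half \<Longrightarrow> y \<noteq> z \<Longrightarrow> dist y z < \<rho> \<Longrightarrow> y \<in> below c"
    unfolding eventually_at by auto
  have sub: "ball z \<rho> \<inter> upper_half \<subseteq> below c"
  proof
    fix y assume "y \<in> ball z \<rho> \<inter> upper_half"
    then show "y \<in> below c" using r(2)[of y] assms by (cases "y = z") (auto simp: dist_commute)
  qed
  have "path_component (below c) z y" if "y \<in> ball z \<rho> \<inter> upper_half" for y
    by (rule convex_path_component[OF _ sub])
       (use that zH r(1) convex_upper_half in \<open>auto intro: convex_Int\<close>)
  with that r(1) sub show thesis by blast
qed

lemma far_regular:
  assumes "0 < \<delta>"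
  obtains \<rho> where "0 \<le> \<rho>" "\<And>z. z \<in> upper_half \<Longrightarrow> \<rho> < \<bar>fst z\<bar> \<or> \<rho> < snd z \<Longrightarrow>
     z \<notin> Pos \<union> Neg \<and> \<bar>w z + e * fst z\<bar> < \<delta>"
proof -
  obtain \<rho>1 where r1: "\<And>z. z\<in>upper_half \<Longrightarrow> \<rho>1 < \<bar>fst z\<bar> \<or> \<rho>1 < snd z \<Longrightarrow> \<bar>w z + e * fst z\<bar> < \<delta>"
    using far[OF assms] by blast
  have "bounded (Pos \<union> Neg)" using finite_charges by (simp add: finite_imp_bounded)
  then obtain B where B: "\<And>z. z \<in> Pos \<union> Neg \<Longrightarrow> norm z \<le> B" by (auto simp: bounded_iff)
  have B': "\<bar>fst z\<bar> \<le> B \<and> snd z \<le> B" if "z \<in> Pos \<union> Neg" for z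
    using B[OF that] norm_fst_le[of "fst z" "snd z"] norm_snd_le[of "snd z" "fst z"] by auto
  show thesis
  proof (rule that[of "max 0 (max \<rho>1 B)"])
    fix z assume z: "z \<in> upper_half" and "max 0 (max \<rho>1 B) < \<bar>fst z\<bar> \<or> max 0 (max \<rho>1 B) < snd z"
    then have z': "\<rho>1 < \<bar>fst z\<bar> \<or> \<rho>1 < snd z" "\<not> (\<bar>fst z\<bar> \<le> B \<and> snd z \<le> B)" by auto
    show "z \<notin> Pos \<union> Neg \<and> \<bar>w z + e * fst z\<bar> < \<delta>" using r1[OF z z'(1)] B' z'(2) by blast
  qed simp
qed

text \<open>The weak maximum principle for components: a component of \<open>w < c\<close> contains a negative pole, or it
contains the low end of the axis. Otherwise some \<open>w - \<delta> * x\<^sup>2\<close> would attain a local minimum inside it.\<close>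

lemma reach:
  "\<exists>K. (\<forall>x. K \<le> e * x \<longrightarrow> (x, 0) \<in> below c) \<and>
     (\<forall>z\<in>below c. (\<exists>n\<in>Neg. path_component (below c) z n) \<or>
        (\<forall>x. K \<le> e * x \<longrightarrow> path_component (below c) z (x, 0)))"
proof -
  obtain \<rho>1 where r1: "0 \<le> \<rho>1" "\<And>z. z \<in> upper_half \<Longrightarrow> \<rho>1 < \<bar>fst z\<bar> \<or> \<rho>1 < snd z \<Longrightarrow>
     z \<notin> Pos \<union> Neg \<and> \<bar>w z + e * fst z\<bar> < 1" using far_regular[of 1] by auto
  define K where "K = \<bar>e\<bar> * \<rho>1 + \<bar>c\<bar> + 2"
  define A where "A = {z \<in> upper_half. K \<le> e * fst z}"
  have K: "K > \<bar>e\<bar> * \<rho>1" "K > 1 - c" unfolding K_def using mult_nonneg_nonneg[of "\<bar>e\<bar>" \<rho>1] r1(1) by linarith+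
  have AS: "A \<subseteq> below c"
  proof
    fix z assume "z \<in> A"
    then have z: "z \<in> upper_half" "K \<le> e * fst z" by (auto simp: A_def)
    have "\<bar>e\<bar> * \<rho>1 < \<bar>e\<bar> * \<bar>fst z\<bar>"
      using K(1) z(2) abs_ge_self[of "e * fst z"] unfolding abs_mult by linarith
    then have "\<rho>1 < \<bar>fst z\<bar>" by (rule mult_left_less_imp_less) simp
    then show "z \<in> below c" using r1(2)[OF z(1)] z K(2) unfolding sublevel_def by auto
  qed
  have convA: "convex A"
  proof -
    have "A = upper_half \<inter> {z. (e, 0) \<bullet> z \<ge> K}" by (auto simp: A_def inner_prod_def)
    then show ?thesis by (simp add: convex_Int convex_upper_half convex_halfspace_ge)
  qed
  have axis: "(x, 0) \<in> A" if "K \<le> e * x" for x using that by (auto simp: A_def upper_half_def)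
  have main: "\<exists>y\<in>A. path_component (below c) z0 y"
    if z0: "z0 \<in> below c" and noNeg: "\<not> (\<exists>n\<in>Neg. path_component (below c) z0 n)" for z0
  proof (rule ccontr)
    assume noA: "\<not> ?thesis"
    define D where "D = {y. path_component (below c) z0 y}"
    have D_sub: "D \<subseteq> below c" unfolding D_def by (auto dest: path_component_mem)
    have D_Neg: "D \<inter> Neg = {}" using noNeg by (auto simp: D_def)
    have D_reg: "y \<in> upper_half - (Pos \<union> Neg) \<and> w y < c" if "y \<in> D" for y
      using that D_sub D_Neg by (auto simp: sublevel_def)
    have D_ext: "y \<in> D" if "x \<in> D" "path_component (below c) x y" for x y
      using that unfolding D_def by (auto intro: path_component_trans)
    have z0D: "z0 \<in> D" using z0 by (simp add: D_def path_component_refl)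
    \<comment> \<open>The minimum is sought on the part \<open>w \<le> c'\<close> of the component. Unlike the component itself this part is
bounded: far out \<open>w\<close> is close to \<open>- e * x\<close>, so from a far point with \<open>w \<le> c'\<close> the horizontal ray
towards the low end stays in \<open>w < c\<close> and reaches that end.\<close>
    define c' where "c' = (w z0 + c) / 2"
    have c': "w z0 < c'" "c' < c" using D_reg[OF z0D] by (auto simp: c'_def)
    define D' where "D' = {y \<in> D. w y \<le> c'}"
    define \<delta> where "\<delta> = (c - c') / 2"
    obtain \<rho> where r: "0 \<le> \<rho>" "\<And>z. z \<in> upper_half \<Longrightarrow> \<rho> < \<bar>fst z\<bar> \<or> \<rho> < snd z \<Longrightarrow>
       z \<notin> Pos \<union> Neg \<and> \<bar>w z + e * fst z\<bar> < \<delta>" using far_regular[of \<delta>] c' unfolding \<delta>_def by auto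
    define M where "M = max \<rho> ((\<bar>c'\<bar> + \<delta>) / \<bar>e\<bar>)"
    have M: "\<bar>fst y\<bar> \<le> M \<and> snd y \<le> M" if y: "y \<in> D'" for y
    proof (rule ccontr)
      assume nM: "\<not> ?thesis"
      have yD: "y \<in> D" "w y \<le> c'" "y \<in> upper_half" using y D_reg by (auto simp: D'_def)
      have wy: "\<bar>w y + e * fst y\<bar> < \<delta>" using r(2)[OF yD(3)] nM unfolding M_def by linarith
      define L where "L = {z. snd z = snd y \<and> e * fst y \<le> e * fst z}"
      have "L \<subseteq> below c"
      proof
        fix z assume z: "z \<in> L"
        have zH: "z \<in> upper_half" using z yD(3) by (auto simp: L_def upper_half_def)
        have "\<rho> < \<bar>fst z\<bar> \<or> \<rho> < snd z"
        proof (cases "\<rho> < snd y")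
          case False
          then have "M < \<bar>fst y\<bar>" using nM unfolding M_def by linarith
          then have "\<bar>e\<bar> * M < \<bar>e * fst y\<bar>" using tilt by (simp add: abs_mult)
          moreover have "\<bar>c'\<bar> + \<delta> \<le> \<bar>e\<bar> * M"
            using mult_left_mono[of "(\<bar>c'\<bar> + \<delta>) / \<bar>e\<bar>" M "\<bar>e\<bar>"] tilt unfolding M_def by simp
          ultimately have "\<bar>e\<bar> * M < e * fst y" using wy yD(2) by linarith
          also have "\<dots> \<le> \<bar>e\<bar> * \<bar>fst z\<bar>" using z abs_ge_self[of "e * fst z"] by (auto simp: L_def abs_mult)
          finally have "M < \<bar>fst z\<bar>" by (rule mult_left_less_imp_less) simp
          then show ?thesis unfolding M_def by linarith
        qed (use z in \<open>auto simp: L_def\<close>)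
        from r(2)[OF zH this] have zr: "z \<notin> Pos \<union> Neg" "\<bar>w z + e * fst z\<bar> < \<delta>" by auto
        moreover have "e * fst y \<le> e * fst z" using z by (simp add: L_def)
        ultimately have "w z < c" using wy yD(2) unfolding \<delta>_def by argo
        then show "z \<in> below c" using zH zr(1) by (auto simp: sublevel_def)
      qed
      moreover have "convex L"
      proof -
        have "L = {z. (0, 1) \<bullet> z = snd y} \<inter> {z. (e, 0) \<bullet> z \<ge> e * fst y}"
          by (auto simp: L_def inner_prod_def)
        then show ?thesis by (metis convex_Int convex_hyperplane convex_halfspace_ge)
      qed
      moreover define x where "x = max K (e * fst y) / e"
      have x: "K \<le> e * x" "e * fst y \<le> e * x" using tilt by (auto simp: x_def)
      then have "(x, snd y) \<in> L" "(x, snd y) \<in> A" using yD(3) by (auto simp: L_def A_def upper_half_def)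
      moreover have "y \<in> L" by (simp add: L_def)
      ultimately have "path_component (below c) y (x, snd y)" by (intro convex_path_component)
      then show False using D_ext[OF yD(1)] noA \<open>(x, snd y) \<in> A\<close> by (auto simp: D_def)
    qed
    have "closed D'"
    proof (rule closure_subset_eq[THEN iffD1], rule subsetI)
      fix y assume "y \<in> closure D'"
      then have near: "\<exists>d\<in>D'. d \<in> ball y \<rho> \<inter> upper_half" if "\<rho> > 0" for \<rho>
        using that D_reg unfolding closure_approachable D'_def by (fastforce simp: dist_commute)
      have yH: "y \<in> upper_half"
      proof -
        have "D' \<subseteq> upper_half" using D_reg by (auto simp: D'_def)
        then show ?thesis using \<open>y \<in> closure D'\<close> closure_minimal closed_upper_half by blast
      qed
      have "y \<notin> above c'"
      proof
        assume "y \<in> above c'"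
        then obtain \<rho> where "\<rho> > 0" "ball y \<rho> \<inter> upper_half \<subseteq> above c'"
          using charged_half_plane.below_open[OF negate] by blast
        then obtain d where "d \<in> D'" "d \<in> above c'" using near by blast
        then show False using D_reg by (auto simp: D'_def sublevel_def)
      qed
      then have wy: "y \<in> Neg \<or> y \<notin> Pos \<and> w y \<le> c'" using yH disjoint_charges by (auto simp: sublevel_def)
      then have "y \<in> below c" using yH c' by (auto simp: sublevel_def)
      then obtain \<rho> where "\<rho> > 0" "\<And>d. d \<in> ball y \<rho> \<inter> upper_half \<Longrightarrow> path_component (below c) y d"
        using below_open by blast
      then obtain d where "d \<in> D'" "path_component (below c) y d" using near by blast
      then have "y \<in> D" using D_ext[of d y] path_component_sym[of _ y d] by (simp add: D'_def)
      then show "y \<in> D'" using wy D_Neg by (auto simp: D'_def)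
    qed
    moreover have "bounded D'"
    proof (rule bounded_subset)
      show "bounded (cbox (- M, - M) (M, M))" by (rule bounded_cbox)
      show "D' \<subseteq> cbox (- M, - M) (M, M)"
        using M D_reg by (force simp: D'_def upper_half_def cbox_Pair_eq abs_le_iff)
    qed
    ultimately have "compact D'" by (simp add: compact_eq_bounded_closed)
    \<comment> \<open>On this part \<open>x\<^sup>2 \<le> M\<^sup>2\<close>, so the perturbation is too small to lift \<open>w z0\<close> up to \<open>c'\<close>, and the minimum of the
perturbed function is attained at a point with \<open>w < c'\<close>, which is an interior point of the part.\<close>
    define \<epsilon> where "\<epsilon> = (c' - w z0) / (M\<^sup>2 + 1)"
    have pos: "M\<^sup>2 + 1 > 0" by (simp add: add_nonneg_pos)
    then have \<epsilon>: "\<epsilon> > 0" using c' by (simp add: \<epsilon>_def)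
    have "continuous_on D' w"
      unfolding continuous_on_eq_continuous_within
    proof
      fix y assume "y \<in> D'"
      then have "y \<in> upper_half - (Pos \<union> Neg)" "D' \<subseteq> upper_half" using D_reg by (auto simp: D'_def)
      then show "continuous (at y within D') w" using continuous continuous_within_subset by blast
    qed
    then have "continuous_on D' (\<lambda>y. w y - \<epsilon> * (fst y)\<^sup>2)" by (intro continuous_intros)
    moreover have "z0 \<in> D'" using z0D c' by (simp add: D'_def)
    ultimately obtain z1 where z1: "z1 \<in> D'" "\<And>y. y \<in> D' \<Longrightarrow> w z1 - \<epsilon> * (fst z1)\<^sup>2 \<le> w y - \<epsilon> * (fst y)\<^sup>2"
      using continuous_attains_inf[OF \<open>compact D'\<close>, of "\<lambda>y. w y - \<epsilon> * (fst y)\<^sup>2"] by blast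
    have "(fst z1)\<^sup>2 \<le> M\<^sup>2" using M[OF z1(1)] by (intro abs_le_square_iff[THEN iffD1]) linarith
    then have "\<epsilon> * (fst z1)\<^sup>2 < \<epsilon> * (M\<^sup>2 + 1)" using \<epsilon> by (intro mult_strict_left_mono) auto
    also have "\<dots> = c' - w z0" using pos by (simp add: \<epsilon>_def)
    finally have "w z1 < c'" 
      using z1(2)[OF \<open>z0 \<in> D'\<close>] mult_nonneg_nonneg[of \<epsilon> "(fst z0)\<^sup>2"] zero_le_power2[of "fst z0"] \<epsilon> by linarith
    have z1D: "z1 \<in> D" using z1 by (simp add: D'_def)
    then have "z1 \<in> below c'" using D_reg[OF z1D] \<open>w z1 < c'\<close> by (auto simp: sublevel_def)
    then obtain \<rho>2 where r2: "\<rho>2 > 0" "ball z1 \<rho>2 \<inter> upper_half \<subseteq> below c'"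
      using below_open by blast
    obtain \<rho>3 where r3: "\<rho>3 > 0" "\<And>d. d \<in> ball z1 \<rho>3 \<inter> upper_half \<Longrightarrow> path_component (below c) z1 d"
      using below_open z1D D_sub by blast
    obtain y where y: "y \<in> ball z1 (min \<rho>2 \<rho>3) \<inter> upper_half" "w y - \<epsilon> * (fst y)\<^sup>2 < w z1 - \<epsilon> * (fst z1)\<^sup>2"
      using no_min[of z1 \<epsilon> "min \<rho>2 \<rho>3"] \<epsilon> r2(1) r3(1) D_reg[OF z1D] by auto
    have "y \<in> D" using D_ext[OF z1D] r3(2) y(1) by auto
    moreover have "y \<in> below c'" using r2(2) y(1) by auto
    ultimately have "y \<in> D'" using D_reg D_Neg by (auto simp: D'_def sublevel_def)
    then show False using z1(2)[of y] y(2) by linarith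
  qed
  show ?thesis
  proof (intro exI[of _ K] conjI allI impI ballI)
    show "(x, 0) \<in> below c" if "K \<le> e * x" for x using axis[OF that] AS by blast
    show "(\<exists>n\<in>Neg. path_component (below c) z n) \<or>
        (\<forall>x. K \<le> e * x \<longrightarrow> path_component (below c) z (x, 0))" if z: "z \<in> below c" for z
    proof (rule disjCI)
      assume "\<not> (\<forall>x. K \<le> e * x \<longrightarrow> path_component (below c) z (x, 0))"
      show "\<exists>n\<in>Neg. path_component (below c) z n"
      proof (rule ccontr)
        assume "\<not> ?thesis"
        then obtain y where y: "y \<in> A" "path_component (below c) z y" using main[OF z] by blast
        have "path_component (below c) z (x, 0)" if "K \<le> e * x" for x
          using y(2) convex_path_component[OF convA AS y(1) axis[OF that]] by (rule path_component_trans)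
        then show False using \<open>\<not> (\<forall>x. K \<le> e * x \<longrightarrow> path_component (below c) z (x, 0))\<close> by blast
      qed
    qed
  qed
qed

text \<open>The sublevel sets below \<open>c\<close> form an increasing family of relatively open sets with union \<open>below c\<close>.\<close>

lemma compact_below:
  assumes "compact C" "C \<subseteq> below c"
  obtains h where "h < c" "C \<subseteq> below h"
proof -
  have "\<exists>h \<rho>. h < c \<and> \<rho> > 0 \<and> ball z \<rho> \<inter> upper_half \<subseteq> below h" if "z \<in> C" for z
  proof -
    have "z \<in> below c" using that assms(2) by blast
    then have "z \<in> Neg \<or> w z < c" by (auto simp: sublevel_def)
    then have "\<exists>h<c. z \<in> below h"
    proof
      assume "z \<in> Neg"
      then have "z \<in> below (c - 1)" using \<open>z \<in> below c\<close> by (auto simp: sublevel_def)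
      then show ?thesis by (intro exI[of _ "c - 1"]) simp
    next
      assume "w z < c"
      then obtain h where "w z < h" "h < c" using dense by blast
      then show ?thesis using \<open>z \<in> below c\<close> by (intro exI[of _ h]) (auto simp: sublevel_def)
    qed
    then show ?thesis using below_open by metis
  qed
  then obtain h \<rho> where h: "\<And>z. z \<in> C \<Longrightarrow> h z < c \<and> \<rho> z > 0 \<and> ball z (\<rho> z) \<inter> upper_half \<subseteq> below (h z)"
    by metis
  have "C \<subseteq> (\<Union>z\<in>C. ball z (\<rho> z))" using h by force
  then obtain F where F: "F \<subseteq> C" "finite F" "C \<subseteq> (\<Union>z\<in>F. ball z (\<rho> z))"
    using compactE_image[OF assms(1), of C "\<lambda>z. ball z (\<rho> z)"] by auto
  define H where "H = Max (insert (c - 1) (h ` F))"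
  have "finite (insert (c - 1) (h ` F))" using F by simp
  moreover have "\<forall>x\<in>insert (c - 1) (h ` F). x < c" using h F(1) by auto
  ultimately have "H < c" unfolding H_def by (subst Max_less_iff) auto
  moreover have "C \<subseteq> below H"
  proof
    fix x assume x: "x \<in> C"
    then obtain z where z: "z \<in> F" "x \<in> ball z (\<rho> z)" using F by blast
    have "x \<in> upper_half" using x assms(2) sublevel_upper_half by blast
    then have "x \<in> below (h z)" using h[of z] z F(1) by blast
    moreover have "h z \<le> H" unfolding H_def using F(2) z(1) by (intro Max_ge) auto
    ultimately show "x \<in> below H" using sublevel_mono by blast
  qed
  ultimately show thesis using that by blast
qed

lemma axis_segment_below:
  assumes "\<And>x. x \<in> {l..r} \<Longrightarrow> w (x, 0) < c" "l \<le> r"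
  shows "path_component (below c) (l, 0) (r, 0)"
proof (rule convex_path_component)
  show "convex ({l..r} \<times> {0 :: real})" by (intro convex_Times) auto
  show "{l..r} \<times> {0} \<subseteq> below c" using assms(1) below_axis by auto
qed (use assms(2) in auto)

text \<open>The maxima are divided according to whether the two ends of their interval are joined in \<open>below (c i)\<close>.
Those with joined ends inject into the positive poles; for the others, \<open>card_merges_less\<close> is applied to the
negative poles together with the low end of the axis.\<close>

lemma card_axis_maxima_le:
  fixes l r q c :: "'i :: linorder \<Rightarrow> real"
  assumes fin: "finite I" and inj: "inj_on c I"
    and sep: "\<And>i j. i \<in> I \<Longrightarrow> j \<in> I \<Longrightarrow> i < j \<Longrightarrow> r i \<le> l j"
    and lqr: "\<And>i. i \<in> I \<Longrightarrow> l i < q i \<and> q i < r i"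
    and max: "\<And>i x. i \<in> I \<Longrightarrow> x \<in> {l i..r i} \<Longrightarrow> w (x, 0) \<le> c i"
    and q: "\<And>i. i \<in> I \<Longrightarrow> w (q i, 0) = c i"
    and ends: "\<And>i. i \<in> I \<Longrightarrow> w (l i, 0) < c i \<and> w (r i, 0) < c i"
  shows "card I \<le> card Pos + card Neg"
proof -
  define joined where "joined i \<longleftrightarrow> path_component (below (c i)) (l i, 0) (r i, 0)" for i
  define I1 I2 where "I1 = {i \<in> I. joined i}" and "I2 = {i \<in> I. \<not> joined i}"
  have "card I1 \<le> card Pos"
  proof -
    have "\<exists>h p. p \<in> Pos \<and> path_component (above h) (q i, 0) p
        \<and> (\<forall>t. path_component (above h) (q i, 0) (t, 0) \<longrightarrow> l i < t \<and> t < r i)" if i: "i \<in> I1" for i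
    proof -
      have iI: "i \<in> I" using i by (simp add: I1_def)
      have "path_component (below (c i)) (l i, 0) (r i, 0)" using i by (simp add: I1_def joined_def)
      then obtain f where f: "path f" "path_image f \<subseteq> below (c i)" "pathstart f = (l i, 0)" "pathfinish f = (r i, 0)"
        by (auto simp: path_component_def)
      \<comment> \<open>Slightly below the maximal level the joining path is still a barrier, while \<open>q i\<close> already lies in the open
superlevel set, so there is a component that grows from it.\<close>
      obtain h where h: "h < c i" "path_image f \<subseteq> below h"
        using compact_below[OF compact_path_image[OF f(1)] f(2)] by blast
      have lr: "path_component (below h) (l i, 0) (r i, 0)"
        using f h by (auto simp: path_component_def)
      have trap: "l i < t \<and> t < r i" if "path_component (above h) (q i, 0) (t, 0)" for t
        using trapped_path_component[OF lr that below_above_disjoint] lqr[OF iI] sublevel_upper_half by auto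
      have qh: "(q i, 0) \<in> above h" using h(1) q[OF iI] by (simp add: above_axis)
      obtain K where K: "(\<exists>p\<in>Pos. path_component (above h) (q i, 0) p) \<or>
        (\<forall>x. K \<le> - e * x \<longrightarrow> path_component (above h) (q i, 0) (x, 0))"
        using charged_half_plane.reach[OF negate, of "- h"] qh by blast
      have "\<not> (\<forall>x. K \<le> - e * x \<longrightarrow> path_component (above h) (q i, 0) (x, 0))"
      proof
        assume *: "\<forall>x. K \<le> - e * x \<longrightarrow> path_component (above h) (q i, 0) (x, 0)"
        define x where "x = - max K (max (- e * l i) (- e * r i)) / e"
        have "- e * x = max K (max (- e * l i) (- e * r i))" using tilt by (simp add: x_def)
        then have x: "K \<le> - e * x" "- e * l i \<le> - e * x" "- e * r i \<le> - e * x" by linarith+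
        then have "l i < x" "x < r i" using * trap by blast+
        then show False
          using x(2,3) tilt by (cases "e > 0") (auto simp: mult_le_cancel_left)
      qed
      then show ?thesis using K trap by blast
    qed
    then obtain h p where hp: "\<And>i. i \<in> I1 \<Longrightarrow> p i \<in> Pos \<and> path_component (above (h i)) (q i, 0) (p i)
        \<and> (\<forall>t. path_component (above (h i)) (q i, 0) (t, 0) \<longrightarrow> l i < t \<and> t < r i)"
      by metis
    \<comment> \<open>If two maxima caught the same pole, the component of the one with the higher level would be part of the other
component, which is trapped over a disjoint interval.\<close>
    have clash: "i = j" if ij: "i \<in> I1" "j \<in> I1" "p i = p j" "h j \<le> h i" for i j
    proof (rule ccontr)
      assume "i \<noteq> j"
      have "above (h i) \<subseteq> above (h j)" by (rule sublevel_mono) (use ij in simp)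
      then have "path_component (above (h j)) (q i, 0) (p j)"
        using hp[OF ij(1)] ij(3) path_component_of_subset by metis
      then have "path_component (above (h j)) (q j, 0) (q i, 0)"
        using hp[OF ij(2)] path_component_sym path_component_trans by metis
      then have "l j < q i" "q i < r j" using hp[OF ij(2)] by blast+
      moreover have "i \<in> I" "j \<in> I" using ij by (auto simp: I1_def)
      ultimately show False using sep[of i j] sep[of j i] lqr[of i] lqr[of j] \<open>i \<noteq> j\<close>
        by (cases i j rule: linorder_cases) force+
    qed
    have "inj_on p I1"
    proof (rule inj_onI)
      fix i j assume "i \<in> I1" "j \<in> I1" "p i = p j"
      then show "i = j" using clash[of i j] clash[of j i] by (cases "h j \<le> h i") auto
    qed
    then show ?thesis using hp finite_charges(1) by (intro card_inj_on_le[of p]) auto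
  qed
  moreover have "card I2 \<le> card Neg"
  proof -
    define t0 where "t0 = Min (insert 0 (c ` I2))"
    have I2: "finite I2" "I2 \<subseteq> I" using fin by (auto simp: I2_def)
    have t0: "t0 \<le> c i" if "i \<in> I2" for i
      unfolding t0_def by (rule Min_le) (use I2 that in auto)
    obtain K where K: "\<And>t x. K t \<le> e * x \<Longrightarrow> (x, 0) \<in> below t"
      "\<And>t z. z \<in> below t \<Longrightarrow> (\<exists>n\<in>Neg. path_component (below t) z n) \<or>
        (\<forall>x. K t \<le> e * x \<longrightarrow> path_component (below t) z (x, 0))"
      using reach by metis
    \<comment> \<open>A single point of the axis, far enough towards the low end, stands for that end at all levels in play.\<close>
    define x0 where "x0 = Max (insert (K t0) ((\<lambda>i. K (c i)) ` I2)) / e"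
    have "k \<le> e * x0" if "k \<in> insert (K t0) ((\<lambda>i. K (c i)) ` I2)" for k
      using Max_ge[OF _ that] I2(1) tilt by (simp add: x0_def)
    then have x0: "K t0 \<le> e * x0" "\<And>i. i \<in> I2 \<Longrightarrow> K (c i) \<le> e * x0" by auto
    define T where "T = insert (x0, 0) Neg"
    have target: "\<exists>a\<in>T. path_component (below (c i)) z a" if "i \<in> I2" "z \<in> below (c i)" for i z
      using K(2)[OF that(2)] x0(2)[OF that(1)] unfolding T_def by blast
    have "\<exists>a b. a \<in> T \<and> b \<in> T \<and> path_component (below (c i)) (l i, 0) a \<and> path_component (below (c i)) (r i, 0) b"
      if "i \<in> I2" for i
    proof -
      have "(l i, 0) \<in> below (c i)" "(r i, 0) \<in> below (c i)"
        using ends[of i] I2(2) that by (auto simp: below_axis)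
      then show ?thesis using target[OF that] by metis
    qed
    then obtain a b where ab: "\<And>i. i \<in> I2 \<Longrightarrow> a i \<in> T \<and> b i \<in> T \<and>
        path_component (below (c i)) (l i, 0) (a i) \<and> path_component (below (c i)) (r i, 0) (b i)"
      by metis
    have "card I2 < card T"
    proof (rule card_merges_less[where E = "\<lambda>t. path_component (below t)" and c = c and a = a and b = b])
      show "path_component (below t) x x" if "t0 \<le> t" "x \<in> T" for t x
      proof (rule path_component_refl)
        have "x \<in> below t0" if "x \<in> Neg"
          using that charges_inside[of x] by (simp add: sublevel_def upper_half_def)
        then have "x \<in> below t0" using that(2) K(1)[OF x0(1)] by (auto simp: T_def)
        then show "x \<in> below t" using sublevel_mono that(1) by blast
      qed
      show "path_component (below t') x y" if "t \<le> t'" "path_component (below t) x y" for t t' x y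
        using that sublevel_mono path_component_of_subset by metis
      show "\<not> path_component (below (c i)) (a i) (b i)" if "i \<in> I2" for i
      proof
        assume "path_component (below (c i)) (a i) (b i)"
        then have "path_component (below (c i)) (l i, 0) (r i, 0)"
          using ab[OF that] path_component_sym path_component_trans by metis
        then show False using that by (simp add: I2_def joined_def)
      qed
      show "path_component (below t) (a i) (b i)" if i: "i \<in> I2" "c i < t" for i t
      proof -
        have "below (c i) \<subseteq> below t" using sublevel_mono i(2) by (simp add: less_imp_le)
        then have "path_component (below t) (l i, 0) (a i)" "path_component (below t) (r i, 0) (b i)"
          using ab[OF i(1)] path_component_of_subset by blast+
        moreover have "path_component (below t) (l i, 0) (r i, 0)"
        proof (rule axis_segment_below)
          have iI: "i \<in> I" using i I2 by blast
          show "w (x, 0) < t" if "x \<in> {l i..r i}" for x using max[OF iI that] i(2) by linarith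
          show "l i \<le> r i" using lqr[OF iI] by linarith
        qed
        ultimately show ?thesis using path_component_sym path_component_trans by metis
      qed
      show "finite T" "T \<noteq> {}" using finite_charges by (auto simp: T_def)
      show "finite I2" "inj_on c I2" using I2 inj by (auto intro: inj_on_subset)
      show "t0 \<le> c i" "a i \<in> T" "b i \<in> T" if "i \<in> I2" for i using t0 ab that by blast+
      show "path_component (below t) y x" if "path_component (below t) x y" for t x y
        using that by (rule path_component_sym)
      show "path_component (below t) x z"
        if "path_component (below t) x y" "path_component (below t) y z" for t x y z
        using that by (rule path_component_trans)
    qed
    also have "card T \<le> Suc (card Neg)" unfolding T_def using finite_charges(2) by (simp add: card_insert_if)
    finally show ?thesis by simp
  qed
  moreover have "card I = card I1 + card I2"
  proof -
    have "I = I1 \<union> I2" "I1 \<inter> I2 = {}" by (auto simp: I1_def I2_def)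
    then show ?thesis using fin by (metis card_Un_disjoint finite_Un)
  qed
  ultimately show ?thesis by linarith
qed

end

section \<open>Second derivative tests\<close>

lemma local_min_derivatives:
  fixes \<phi> \<phi>' :: "real \<Rightarrow> real"
  assumes d1: "\<forall>\<^sub>F t in nhds x. (\<phi> has_real_derivative \<phi>' t) (at t)"
    and d2: "(\<phi>' has_real_derivative D) (at x)"
    and min: "\<forall>\<^sub>F t in nhds x. \<phi> x \<le> \<phi> t"
  shows "\<phi>' x = 0" "D \<ge> 0"
proof -
  obtain d where d: "d > 0" "\<And>t. \<bar>x - t\<bar> < d \<Longrightarrow> (\<phi> has_real_derivative \<phi>' t) (at t) \<and> \<phi> x \<le> \<phi> t"
    using eventually_conj[OF d1 min] unfolding eventually_nhds_metric by (auto simp: dist_real_def abs_minus_commute)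
  show z: "\<phi>' x = 0"
    using DERIV_local_min[of \<phi> "\<phi>' x" x d] d by auto
  show "D \<ge> 0"
  proof (rule ccontr)
    assume "\<not> D \<ge> 0"
    then obtain d' where d': "d' > 0" "\<And>h. 0 < h \<Longrightarrow> h < d' \<Longrightarrow> \<phi>' (x + h) < 0"
      using DERIV_neg_dec_right[OF d2] z by auto
    define h where "h = min d d' / 2"
    have h: "h > 0" "h < d" "h < d'" using d(1) d'(1) by (auto simp: h_def min_def)
    have "\<exists>t. x < t \<and> t < x + h \<and> \<phi> (x + h) - \<phi> x = (x + h - x) * \<phi>' t"
      by (rule MVT2) (use d(2) h in auto)
    then obtain t where t: "x < t" "t < x + h" "\<phi> (x + h) - \<phi> x = h * \<phi>' t" by auto
    then have "\<phi>' t < 0" using d'(2)[of "t - x"] h by auto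
    then have "\<phi> (x + h) < \<phi> x" using t(3) h(1) mult_pos_neg[of h "\<phi>' t"] by linarith
    moreover have "\<phi> x \<le> \<phi> (x + h)" using d(2)[of "x + h"] h by auto
    ultimately show False by linarith
  qed
qed

lemma right_min_derivative:
  fixes \<phi> :: "real \<Rightarrow> real"
  assumes d1: "(\<phi> has_real_derivative D) (at x)"
    and min: "\<forall>\<^sub>F t in nhds x. x \<le> t \<longrightarrow> \<phi> x \<le> \<phi> t"
  shows "D \<ge> 0"
proof (rule ccontr)
  assume "\<not> D \<ge> 0"
  then obtain d' where d': "d' > 0" "\<And>h. 0 < h \<Longrightarrow> h < d' \<Longrightarrow> \<phi> (x + h) < \<phi> x"
    using DERIV_neg_dec_right[OF d1] by auto
  obtain d where d: "d > 0" "\<And>t. \<bar>t - x\<bar> < d \<Longrightarrow> x \<le> t \<Longrightarrow> \<phi> x \<le> \<phi> t"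
    using min unfolding eventually_nhds_metric by (auto simp: dist_real_def)
  define h where "h = min d d' / 2"
  have h: "h > 0" "h < d" "h < d'" using d(1) d'(1) by (auto simp: h_def min_def)
  show False using d(2)[of "x + h"] d'(2)[of h] h by auto
qed

section \<open>Off-axis charges and their extension\<close>

definition line_potential :: "real \<Rightarrow> (real \<times> real) set \<Rightarrow> (real \<times> real \<Rightarrow> real) \<Rightarrow> real \<Rightarrow> real" where
  "line_potential s Q \<zeta> x = (\<Sum>(a, b)\<in>Q. \<zeta> (a, b) * ((x - a)\<^sup>2 + b\<^sup>2) powr - s)"

locale ring_charges =
  fixes s :: real and Q :: "(real \<times> real) set" and \<zeta> :: "real \<times> real \<Rightarrow> real"
  assumes s: "s > 0" and finQ: "finite Q"
    and off_axis: "\<And>a b. (a, b) \<in> Q \<Longrightarrow> b > 0"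
    and nonzero: "\<And>q. q \<in> Q \<Longrightarrow> \<zeta> q \<noteq> 0"
begin

definition extension :: "real \<Rightarrow> real \<times> real \<Rightarrow> real" where
  "extension e z = (\<Sum>(a, b)\<in>Q. \<zeta> (a, b) * ring_kernel s a b (fst z) (snd z)) - e * fst z"

text \<open>The second coordinate is squared because \<open>y\<close> measures squared distance from the axis.\<close>

definition location :: "real \<times> real \<Rightarrow> real \<times> real" where
  "location q = (fst q, (snd q)\<^sup>2)"

lemma ring_point: "(a, b) \<in> Q \<Longrightarrow> ring_point s b"
  using s off_axis by (simp add: ring_point_def)

lemma inj_location: "inj_on location Q"
proof (rule inj_onI)
  fix p q assume pq: "p \<in> Q" "q \<in> Q" "location p = location q"
  then have "snd p > 0" "snd q > 0" using off_axis by (metis prod.collapse)+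
  then show "p = q" using pq(3) by (auto simp: location_def prod_eq_iff)
qed

lemma eventually_regular:
  assumes "z \<in> upper_half - location ` Q" "f z0 = z" "isCont f z0"
  shows "\<forall>\<^sub>F t in nhds z0. f t \<in> - location ` Q"
proof -
  have "open (- location ` Q)" using finQ by (intro open_Compl finite_imp_closed) simp
  then have "\<forall>\<^sub>F y in nhds z. y \<in> - location ` Q"
    using assms(1) by (intro eventually_nhds_in_open) auto
  moreover have "filterlim f (nhds z) (nhds z0)"
    using assms(2,3) by (simp add: isCont_def tendsto_nhds_iff)
  ultimately show ?thesis by (rule eventually_compose_filterlim)
qed

text \<open>At a local minimum of \<open>w - \<delta> * x\<^sup>2\<close> the second derivative test gives \<open>u\<^bsub>xx\<^esub> \<ge> 2 * \<delta>\<close> for the sum \<open>u\<close> of the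
kernels. Off the axis it also gives \<open>u\<^bsub>y\<^esub> = 0\<close> and \<open>u\<^bsub>yy\<^esub> \<ge> 0\<close>, and on the axis, where the term with \<open>u\<^bsub>yy\<^esub>\<close> drops out
of the equation, the one-sided test gives \<open>u\<^bsub>y\<^esub> \<ge> 0\<close>. Both contradict the differential equation.\<close>

lemma no_min:
  assumes z: "z \<in> upper_half - location ` Q" and "0 < \<delta>" "0 < \<rho>"
  shows "\<exists>y \<in> ball z \<rho> \<inter> upper_half. extension e y - \<delta> * (fst y)\<^sup>2 < extension e z - \<delta> * (fst z)\<^sup>2"
proof (rule ccontr)
  assume "\<not> ?thesis"
  then have min: "extension e z - \<delta> * (fst z)\<^sup>2 \<le> extension e u - \<delta> * (fst u)\<^sup>2"
    if "u \<in> ball z \<rho>" "u \<in> upper_half" for u using that by (auto simp: not_less)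
  obtain x y where xy: "z = (x, y)" by (cases z)
  have y: "y \<ge> 0" using z by (simp add: xy upper_half_def)
  let ?S = "\<lambda>k x y. \<Sum>(a, b)\<in>Q. \<zeta> (a, b) * k a b x y"
  let ?kx = "ring_point.kx s" and ?kxx = "ring_point.kxx s" and ?ky = "ring_point.ky s" and ?kyy = "ring_point.kyy s"
  have reg: "ring_point.R a b x y > 0 \<and> \<bar>ring_point.q a b x y\<bar> < 1"
    if "(x, y) \<notin> location ` Q" "y \<ge> 0" "(a, b) \<in> Q" for a b x y
  proof -
    have "(x, y) \<noteq> (a, b\<^sup>2)" using that(1,3) by (force simp: location_def)
    then show ?thesis using ring_point.regular[OF ring_point[OF that(3)] that(2)] by auto
  qed
  have d: "((\<lambda>x. ?S (ring_kernel s) x y) has_real_derivative ?S ?kx x y) (at x)"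
          "((\<lambda>x. ?S ?kx x y) has_real_derivative ?S ?kxx x y) (at x)"
          "((\<lambda>y. ?S (ring_kernel s) x y) has_real_derivative ?S ?ky x y) (at y)"
          "((\<lambda>y. ?S ?ky x y) has_real_derivative ?S ?kyy x y) (at y)"
    if "(x, y) \<notin> location ` Q" "y \<ge> 0" for x y
    using reg[OF that]
    by (auto intro!: DERIV_sum DERIV_cmult ring_point.DERIV_kernel_x ring_point.DERIV_kernel_y ring_point)
  have pde: "?S ?kxx x y + 4 * y * ?S ?kyy x y + 2 * (1 + 2 * s) * ?S ?ky x y = 0"
  proof -
    have "?S ?kxx x y + 4 * y * ?S ?kyy x y + 2 * (1 + 2 * s) * ?S ?ky x y
      = (\<Sum>(a, b)\<in>Q. \<zeta> (a, b) * (?kxx a b x y + 4 * y * ?kyy a b x y + 2 * (1 + 2 * s) * ?ky a b x y))"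
      by (simp add: sum_distrib_left sum.distrib case_prod_unfold algebra_simps)
    also have "\<dots> = 0"
      using ring_point.kernel_PDE[OF ring_point] reg[of x y] z y by (intro sum.neutral) (auto simp: xy)
    finally show ?thesis .
  qed
  have near: "\<forall>\<^sub>F t in nhds z0. f t \<in> ball z \<rho> \<and> f t \<notin> location ` Q"
    if "f z0 = z" "isCont f z0" for f :: "real \<Rightarrow> real \<times> real" and z0
  proof -
    have "filterlim f (nhds z) (nhds z0)" using that by (simp add: isCont_def tendsto_nhds_iff)
    moreover have "\<forall>\<^sub>F u in nhds z. u \<in> ball z \<rho>" using \<open>0 < \<rho>\<close> by (intro eventually_nhds_in_open) auto
    ultimately have "\<forall>\<^sub>F t in nhds z0. f t \<in> ball z \<rho>" by (rule eventually_compose_filterlim[rotated])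
    then show ?thesis using eventually_regular[OF z that] by eventually_elim auto
  qed
  have nx: "\<forall>\<^sub>F t in nhds x. (t, y) \<in> ball z \<rho> \<and> (t, y) \<notin> location ` Q"
    by (rule near) (auto simp: xy intro!: continuous_intros)
  have ny: "\<forall>\<^sub>F t in nhds y. (x, t) \<in> ball z \<rho> \<and> (x, t) \<notin> location ` Q"
    by (rule near) (auto simp: xy intro!: continuous_intros)
  have lin: "((\<lambda>t. e * t) has_real_derivative e) (at t)"
    and quad: "((\<lambda>t. \<delta> * t\<^sup>2) has_real_derivative 2 * \<delta> * t) (at t)"
    and quad': "((\<lambda>t. e + 2 * \<delta> * t) has_real_derivative 2 * \<delta>) (at t)" for t
    by (auto intro!: derivative_eq_intros)
  have "?S ?kxx x y - 2 * \<delta> \<ge> 0"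
  proof (rule local_min_derivatives(2))
    show "\<forall>\<^sub>F t in nhds x. ((\<lambda>t. extension e (t, y) - \<delta> * t\<^sup>2) has_real_derivative
        (?S ?kx t y - e - 2 * \<delta> * t)) (at t)"
      using nx unfolding extension_def fst_conv snd_conv
      by eventually_elim (intro DERIV_diff lin quad d y, simp)
    show "((\<lambda>t. ?S ?kx t y - e - 2 * \<delta> * t) has_real_derivative (?S ?kxx x y - 2 * \<delta>)) (at x)"
      unfolding diff_diff_eq using z y by (intro DERIV_diff quad' d) (auto simp: xy)
    show "\<forall>\<^sub>F t in nhds x. extension e (x, y) - \<delta> * x\<^sup>2 \<le> extension e (t, y) - \<delta> * t\<^sup>2"
      using nx by eventually_elim (use min y in \<open>auto simp: xy upper_half_def\<close>)
  qed
  moreover have "4 * y * ?S ?kyy x y \<ge> 0 \<and> ?S ?ky x y \<ge> 0"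
  proof (cases "y = 0")
    case True
    have "?S ?ky x y \<ge> 0"
    proof (rule right_min_derivative)
      show "((\<lambda>t. extension e (x, t) - \<delta> * x\<^sup>2) has_real_derivative ?S ?ky x y) (at y)"
        unfolding extension_def fst_conv snd_conv diff_diff_eq
        using z y d(3)[of x y] DERIV_diff[OF _ DERIV_const, of _ _ y] by (force simp: xy)
      show "\<forall>\<^sub>F t in nhds y. y \<le> t \<longrightarrow> extension e (x, y) - \<delta> * x\<^sup>2 \<le> extension e (x, t) - \<delta> * x\<^sup>2"
        using ny
      proof eventually_elim
        case (elim t)
        then show ?case using min[of "(x, t)"] y by (simp add: xy upper_half_def)
      qed
    qed
    then show ?thesis using True by simp
  next
    case False
    then have "y > 0" using y by simp
    then have "\<forall>\<^sub>F t in nhds y. t > 0" using eventually_nhds_in_open[of "{0<..}" y] by simp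
    note ny' = eventually_conj[OF ny this]
    have 1: "\<forall>\<^sub>F t in nhds y. ((\<lambda>t. extension e (x, t) - \<delta> * x\<^sup>2) has_real_derivative ?S ?ky x t) (at t)"
      using ny' unfolding extension_def fst_conv snd_conv diff_diff_eq
      by eventually_elim (use d(3)[of x] DERIV_diff[OF _ DERIV_const] in force)
    have 2: "((\<lambda>t. ?S ?ky x t) has_real_derivative ?S ?kyy x y) (at y)"
      using z y by (intro d) (auto simp: xy)
    have 3: "\<forall>\<^sub>F t in nhds y. extension e (x, y) - \<delta> * x\<^sup>2 \<le> extension e (x, t) - \<delta> * x\<^sup>2"
      using ny'
    proof eventually_elim
      case (elim t)
      then show ?case using min[of "(x, t)"] by (simp add: xy upper_half_def)
    qed
    show ?thesis using local_min_derivatives[OF 1 2 3] y by simp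
  qed
  moreover from this have "2 * (1 + 2 * s) * ?S ?ky x y \<ge> 0" using s by (intro mult_nonneg_nonneg) auto
  ultimately show False using pde \<open>0 < \<delta>\<close> by linarith
qed

lemma kernel_continuous:
  assumes "b > 0" "z \<in> upper_half" "z \<noteq> location (a, b)"
  shows "continuous (at z within upper_half) (\<lambda>z. ring_kernel s a b (fst z) (snd z))"
proof -
  interpret ring_point s a b using s assms(1) by (simp add: ring_point_def)
  obtain x y where xy: "z = (x, y)" by (cases z)
  have reg: "R x y > 0" "0 \<le> q x y" "q x y < 1"
    using regular[of y x] assms(2,3) by (auto simp: xy upper_half_def location_def)
  have R: "isCont (\<lambda>z. R (fst z) (snd z)) z"
    unfolding R_def by (intro continuous_intros)
  then have q: "isCont (\<lambda>z. q (fst z) (snd z)) z"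
    unfolding q_def using reg(1) by (intro continuous_intros) (auto simp: xy)
  have "isCont (ring_series s) (q (fst z) (snd z))"
    using DERIV_isCont[OF DERIV_ring_series[OF s]] reg by (simp add: xy)
  then have "isCont (\<lambda>z. ring_series s (q (fst z) (snd z))) z"
    by (rule isCont_o2[OF q])
  then have "isCont (\<lambda>z. ring_kernel s a b (fst z) (snd z)) z"
    unfolding kernel_eq using R reg(1) by (intro continuous_intros) (auto simp: xy)
  then show ?thesis by (rule continuous_at_imp_continuous_at_within)
qed

text \<open>The argument of the series tends to 1 from the left while the power of \<open>R\<close> keeps a positive limit.\<close>

lemma kernel_at_location:
  assumes "b > 0"
  shows "filterlim (\<lambda>z. ring_kernel s a b (fst z) (snd z)) at_top (at (location (a, b)) within upper_half)"
proof -
  interpret ring_point s a b using s assms(1) by (simp add: ring_point_def)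
  let ?F = "at (location (a, b)) within upper_half"
  have R0: "R a (b\<^sup>2) = 2 * b\<^sup>2" by (simp add: R_def)
  have Rpos: "R a (b\<^sup>2) > 0" using assms by (simp add: R0)
  have q0: "q a (b\<^sup>2) = 1" unfolding q_def R0 using assms by (simp add: power2_eq_square)
  have R: "((\<lambda>z. R (fst z) (snd z)) \<longlongrightarrow> R a (b\<^sup>2)) ?F"
    unfolding R_def location_def by (auto intro!: tendsto_eq_intros)
  then have "((\<lambda>z. q (fst z) (snd z)) \<longlongrightarrow> q a (b\<^sup>2)) ?F"
    unfolding q_def using Rpos by (intro tendsto_intros) (auto simp: location_def intro!: tendsto_eq_intros)
  moreover have "\<forall>\<^sub>F z in ?F. q (fst z) (snd z) < 1"
    unfolding eventually_at_filter
    by (rule always_eventually) (use regular in \<open>force simp: upper_half_def location_def\<close>)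
  ultimately have "filterlim (\<lambda>z. q (fst z) (snd z)) (at_left 1) ?F"
    unfolding q0 by (rule tendsto_imp_filterlim_at_left)
  then have "filterlim (\<lambda>z. ring_series s (q (fst z) (snd z))) at_top ?F"
    by (rule filterlim_compose[OF ring_series_at_top[OF s]])
  moreover have "((\<lambda>z. R (fst z) (snd z) powr - s) \<longlongrightarrow> R a (b\<^sup>2) powr - s) ?F"
    using R Rpos by (intro tendsto_intros) auto
  ultimately show ?thesis
    unfolding kernel_eq using Rpos by (intro filterlim_tendsto_pos_mult_at_top[where c = "R a (b\<^sup>2) powr - s"]) auto
qed

text \<open>Where \<open>R \<ge> 8 * b\<^sup>2\<close>, the argument of the series is at most \<open>1 / 2\<close>, so that the decay of the power of \<open>R\<close> decides.\<close>

lemma kernel_at_infinity: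
  assumes "b > 0"
  shows "((\<lambda>z. ring_kernel s a b (fst z) (snd z)) \<longlongrightarrow> 0) (inf at_infinity (principal upper_half))"
proof -
  interpret ring_point s a b using s assms(1) by (simp add: ring_point_def)
  let ?F = "inf at_infinity (principal upper_half)"
  have Rn: "- (\<bar>a\<bar> + 1) + norm z \<le> R (fst z) (snd z)" if "z \<in> upper_half" for z
  proof -
    have "norm z \<le> \<bar>fst z\<bar> + \<bar>snd z\<bar>" using norm_Pair_le[of "fst z" "snd z"] by simp
    moreover have "2 * \<bar>fst z - a\<bar> \<le> (fst z - a)\<^sup>2 + 1"
      using zero_le_power2[of "\<bar>fst z - a\<bar> - 1"] unfolding power2_diff power2_abs by simp
    moreover have "\<bar>fst z\<bar> \<le> \<bar>fst z - a\<bar> + \<bar>a\<bar>" "0 \<le> \<bar>fst z - a\<bar>" by linarith+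
    moreover have "\<bar>snd z\<bar> = snd z" "0 \<le> b\<^sup>2" using that by (auto simp: upper_half_def)
    ultimately show ?thesis unfolding R_def by argo
  qed
  have "filterlim (\<lambda>z :: real \<times> real. - (\<bar>a\<bar> + 1) + norm z) at_top ?F"
    by (rule filterlim_tendsto_add_at_top[OF tendsto_const])
       (rule filterlim_mono[OF filterlim_norm_at_top order_refl], simp)
  then have R: "filterlim (\<lambda>z. R (fst z) (snd z)) at_top ?F"
    by (rule filterlim_at_top_mono)
       (use Rn in \<open>auto simp: eventually_inf_principal intro!: always_eventually\<close>)
  have bound: "\<forall>\<^sub>F z in ?F. norm (ring_kernel s a b (fst z) (snd z))
     \<le> R (fst z) (snd z) powr - s * ring_series s (1 / 2)"
    using filterlim_at_top[THEN iffD1, OF R, rule_format, of "8 * b\<^sup>2"] unfolding eventually_inf_principal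
  proof eventually_elim
    case (elim z)
    show ?case
    proof
      assume z: "z \<in> upper_half"
      let ?R = "R (fst z) (snd z)" and ?q = "q (fst z) (snd z)"
      have "b\<^sup>2 > 0" using assms by simp
      moreover have "0 \<le> snd z" using z by (simp add: upper_half_def)
      ultimately have R8: "8 * b\<^sup>2 \<le> ?R" "?R > 0" "snd z \<le> ?R" "0 \<le> snd z"
        using elim[THEN mp, OF z] zero_le_power2[of "fst z - a"] unfolding R_def by linarith+
      have "4 * snd z * b\<^sup>2 \<le> ?R * (4 * b\<^sup>2)" using mult_right_mono[OF R8(3), of "4 * b\<^sup>2"] by simp
      also have "\<dots> \<le> ?R * (?R / 2)" using R8 by (intro mult_left_mono) auto
      finally have q: "?q \<le> 1 / 2" using R8(2) unfolding q_def by (simp add: divide_le_eq power2_eq_square)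
      have q0: "0 \<le> ?q" using R8 unfolding q_def by simp
      have "1 \<le> ring_series s ?q" using ring_series_ge_1[OF s q0] q by simp
      moreover have "ring_series s ?q \<le> ring_series s (1 / 2)" using ring_series_mono[OF s q0 q] by simp
      ultimately show "norm (ring_kernel s a b (fst z) (snd z)) \<le> ?R powr - s * ring_series s (1 / 2)"
        unfolding kernel_eq by (simp add: abs_mult mult_left_mono)
    qed
  qed
  have "((\<lambda>z. R (fst z) (snd z) powr - s * ring_series s (1 / 2)) \<longlongrightarrow> 0 * ring_series s (1 / 2)) ?F"
    by (intro tendsto_intros tendsto_neg_powr R) (use s in simp)
  then show ?thesis using Lim_null_comparison[OF bound] by simp
qed

definition "Pos = location ` {q \<in> Q. \<zeta> q > 0}"
definition "Neg = location ` {q \<in> Q. \<zeta> q < 0}"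

lemma Pos_Neg: "Pos \<union> Neg = location ` Q"
  using nonzero unfolding Pos_def Neg_def by (force simp: neq_iff)

text \<open>Near its own pole a charge dominates: the contribution of everything else has a finite limit there.\<close>

lemma extension_near_location:
  assumes "q \<in> Q"
  obtains c where "((\<lambda>z. extension e z - \<zeta> q * ring_kernel s (fst q) (snd q) (fst z) (snd z)) \<longlongrightarrow> c)
     (at (location q) within upper_half)"
proof -
  let ?F = "at (location q) within upper_half"
  have H: "location q \<in> upper_half" by (simp add: location_def upper_half_def)
  have "((\<lambda>z. (\<Sum>p\<in>Q - {q}. \<zeta> p * ring_kernel s (fst p) (snd p) (fst z) (snd z)) - e * fst z)
    \<longlongrightarrow> (\<Sum>p\<in>Q - {q}. \<zeta> p * ring_kernel s (fst p) (snd p) (fst (location q)) (snd (location q))) - e * fst (location q)) ?F"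
  proof (intro tendsto_intros)
    fix p assume p: "p \<in> Q - {q}"
    then have "location q \<noteq> location (fst p, snd p)" using inj_onD[OF inj_location, of q p] assms by auto
    moreover have "snd p > 0" using p off_axis[of "fst p" "snd p"] by simp
    ultimately show "((\<lambda>z. ring_kernel s (fst p) (snd p) (fst z) (snd z)) \<longlongrightarrow>
       ring_kernel s (fst p) (snd p) (fst (location q)) (snd (location q))) ?F"
      using kernel_continuous[OF _ H] unfolding continuous_within by blast
  qed
  moreover have "extension e z - \<zeta> q * ring_kernel s (fst q) (snd q) (fst z) (snd z)
    = (\<Sum>p\<in>Q - {q}. \<zeta> p * ring_kernel s (fst p) (snd p) (fst z) (snd z)) - e * fst z" for z
    unfolding extension_def case_prod_unfold prod.collapse by (simp add: sum.remove[OF finQ assms])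
  ultimately show thesis using that by simp
qed

lemma charged_half_plane:
  assumes "e \<noteq> 0"
  shows "charged_half_plane (extension e) Pos Neg e"
proof
  show "finite Pos" "finite Neg" using finQ by (auto simp: Pos_def Neg_def)
  show "Pos \<inter> Neg = {}" using inj_onD[OF inj_location] by (fastforce simp: Pos_def Neg_def)
  show "0 < snd z" if "z \<in> Pos \<union> Neg" for z
    using that off_axis unfolding Pos_Neg by (force simp: location_def)
  show "e \<noteq> 0" by fact
  show "continuous (at z within upper_half) (extension e)" if z: "z \<in> upper_half - (Pos \<union> Neg)" for z
  proof -
    have "continuous (at z within upper_half) (\<lambda>z. ring_kernel s (fst q) (snd q) (fst z) (snd z))" if "q \<in> Q" for q
      by (rule kernel_continuous) (use that z off_axis[of "fst q" "snd q"] in \<open>auto simp: Pos_Neg\<close>)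
    then show ?thesis unfolding extension_def case_prod_unfold prod.collapse
      by (intro continuous_intros) auto
  qed
  show "filterlim (extension e) at_top (at z within upper_half)" if z: "z \<in> Pos" for z
  proof -
    obtain q where q: "z = location q" "q \<in> Q" "\<zeta> q > 0" using z unfolding Pos_def by blast
    obtain c where c: "((\<lambda>z. extension e z - \<zeta> q * ring_kernel s (fst q) (snd q) (fst z) (snd z)) \<longlongrightarrow> c)
     (at z within upper_half)" using extension_near_location[OF q(2)] q(1) by blast
    have "filterlim (\<lambda>z. ring_kernel s (fst q) (snd q) (fst z) (snd z)) at_top (at z within upper_half)"
      using kernel_at_location[of "snd q" "fst q"] off_axis[of "fst q" "snd q"] q by simp
    then have "filterlim (\<lambda>z. \<zeta> q * ring_kernel s (fst q) (snd q) (fst z) (snd z)) at_top (at z within upper_half)"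
      using q(3) by (intro filterlim_tendsto_pos_mult_at_top[OF tendsto_const])
    from filterlim_tendsto_add_at_top[OF c this] show ?thesis by simp
  qed
  show "filterlim (extension e) at_bot (at z within upper_half)" if z: "z \<in> Neg" for z
  proof -
    obtain q where q: "z = location q" "q \<in> Q" "\<zeta> q < 0" using z unfolding Neg_def by blast
    obtain c where c: "((\<lambda>z. extension e z - \<zeta> q * ring_kernel s (fst q) (snd q) (fst z) (snd z)) \<longlongrightarrow> c)
     (at z within upper_half)" using extension_near_location[OF q(2)] q(1) by blast
    have "filterlim (\<lambda>z. ring_kernel s (fst q) (snd q) (fst z) (snd z)) at_top (at z within upper_half)"
      using kernel_at_location[of "snd q" "fst q"] off_axis[of "fst q" "snd q"] q by simp
    then have "filterlim (\<lambda>z. - \<zeta> q * ring_kernel s (fst q) (snd q) (fst z) (snd z)) at_top (at z within upper_half)"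
      using q(3) by (intro filterlim_tendsto_pos_mult_at_top[OF tendsto_const]) auto
    from filterlim_tendsto_add_at_top[OF tendsto_minus[OF c] this] show ?thesis
      by (simp add: filterlim_uminus_at_bot)
  qed
  show "\<exists>\<rho>. \<forall>z\<in>upper_half. \<rho> < \<bar>fst z\<bar> \<or> \<rho> < snd z \<longrightarrow> \<bar>extension e z + e * fst z\<bar> < \<delta>" if "0 < \<delta>" for \<delta>
  proof -
    have "((\<lambda>z. ring_kernel s (fst q) (snd q) (fst z) (snd z)) \<longlongrightarrow> 0) (inf at_infinity (principal upper_half))"
      if "q \<in> Q" for q
      using kernel_at_infinity[of "snd q" "fst q"] off_axis[of "fst q" "snd q"] that by simp
    then have "((\<lambda>z. \<Sum>q\<in>Q. \<zeta> q * ring_kernel s (fst q) (snd q) (fst z) (snd z)) \<longlongrightarrow> (\<Sum>q\<in>Q. \<zeta> q * 0))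
        (inf at_infinity (principal upper_half))" by (intro tendsto_intros)
    then have "((\<lambda>z. extension e z + e * fst z) \<longlongrightarrow> 0) (inf at_infinity (principal upper_half))"
      by (simp add: extension_def case_prod_unfold)
    then have "\<forall>\<^sub>F z in at_infinity. z \<in> upper_half \<longrightarrow> \<bar>extension e z + e * fst z\<bar> < \<delta>"
      using that by (auto simp: tendsto_iff eventually_inf_principal)
    then obtain B where B: "\<And>z. B \<le> norm z \<Longrightarrow> z \<in> upper_half \<Longrightarrow> \<bar>extension e z + e * fst z\<bar> < \<delta>"
      unfolding eventually_at_infinity by blast
    show ?thesis
    proof (intro exI[of _ B] ballI impI B)
      fix z :: "real \<times> real" assume "B < \<bar>fst z\<bar> \<or> B < snd z"
      then show "B \<le> norm z"
        using norm_fst_le[of "fst z" "snd z"] norm_snd_le[of "snd z" "fst z"] by auto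
    qed
  qed
  show "\<exists>y\<in>ball z \<rho> \<inter> upper_half. extension e y - \<delta> * (fst y)\<^sup>2 < extension e z - \<delta> * (fst z)\<^sup>2"
    if "z \<in> upper_half - (Pos \<union> Neg)" "0 < \<delta>" "0 < \<rho>" for z \<delta> \<rho>
    using no_min that unfolding Pos_Neg by blast
  show "\<exists>y\<in>ball z \<rho> \<inter> upper_half. extension e z + \<delta> * (fst z)\<^sup>2 < extension e y + \<delta> * (fst y)\<^sup>2"
    if z: "z \<in> upper_half - (Pos \<union> Neg)" "0 < \<delta>" "0 < \<rho>" for z \<delta> \<rho>
  proof -
    interpret neg: ring_charges s Q "\<lambda>q. - \<zeta> q"
      by unfold_locales (use s finQ off_axis nonzero in auto)
    have eq: "neg.extension (- e) u = - extension e u" for u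
      unfolding neg.extension_def extension_def by (simp add: case_prod_unfold sum_negf)
    obtain y where "y \<in> ball z \<rho> \<inter> upper_half"
      "- extension e y - \<delta> * (fst y)\<^sup>2 < - extension e z - \<delta> * (fst z)\<^sup>2"
      using neg.no_min[of z \<delta> \<rho> "- e"] z unfolding Pos_Neg eq by blast
    then show ?thesis by (intro bexI[of _ y]) linarith+
  qed
qed

abbreviation potential :: "real \<Rightarrow> real" where
  "potential \<equiv> line_potential s Q \<zeta>"

lemma extension_axis: "extension e (x, 0) = potential x - e * x"
  by (simp add: extension_def line_potential_def ring_kernel_def)

lemma continuous_potential: "continuous_on A potential"
proof -
  have "(x - fst q)\<^sup>2 + (snd q)\<^sup>2 \<noteq> 0" if "q \<in> Q" for x q
    using off_axis[of "fst q" "snd q"] that by (simp add: add_nonneg_eq_0_iff)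
  then show ?thesis unfolding line_potential_def[abs_def] case_prod_unfold
    by (intro continuous_intros) auto
qed

lemma interior_maximum:
  assumes "l < r" "(potential has_real_derivative dl) (at l)" "(potential has_real_derivative dr) (at r)"
    and "dr < e" "e < dl"
  shows "\<exists>q. l < q \<and> q < r \<and> (\<forall>x\<in>{l..r}. potential x - e * x \<le> potential q - e * q) \<and>
    potential l - e * l < potential q - e * q \<and> potential r - e * r < potential q - e * q"
proof -
  let ?g = "\<lambda>x. potential x - e * x"
  have gl: "(?g has_real_derivative dl - e) (at l)" and gr: "(?g has_real_derivative dr - e) (at r)"
    by (auto intro!: derivative_eq_intros assms)
  have "continuous_on {l..r} ?g" by (intro continuous_intros continuous_potential)
  then obtain q where q: "q \<in> {l..r}" "\<And>x. x \<in> {l..r} \<Longrightarrow> ?g x \<le> ?g q"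
    using continuous_attains_sup[of "{l..r}" ?g] assms(1) by auto
  obtain d where d: "d > 0" "\<And>h. 0 < h \<Longrightarrow> h < d \<Longrightarrow> ?g l < ?g (l + h)"
    using DERIV_pos_inc_right[OF gl] assms by auto
  obtain d' where d': "d' > 0" "\<And>h. 0 < h \<Longrightarrow> h < d' \<Longrightarrow> ?g r < ?g (r - h)"
    using DERIV_neg_dec_left[OF gr] assms by auto
  define h where "h = min (min d d') (r - l) / 2"
  have h: "0 < h" "h < d" "h < d'" "h < r - l" using d(1) d'(1) assms(1) by (auto simp: h_def min_def)
  have "?g l < ?g q" using d(2)[of h] q(2)[of "l + h"] h by auto
  moreover have "?g r < ?g q" using d'(2)[of h] q(2)[of "r - h"] h by auto
  moreover from calculation have "q \<noteq> l" "q \<noteq> r" by blast+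
  then have "l < q" "q < r" using q(1) by auto
  ultimately show ?thesis using q(2) by blast
qed

text \<open>Between a point with \<open>f' > e\<close> and a later one with \<open>f' < e\<close>, the function \<open>f - e * x\<close> has an interior maximum.
The inequalities persist for nearby values of \<open>e\<close>, and this freedom is used to make the maximal values
pairwise distinct, as \<open>card_axis_maxima_le\<close> demands.\<close>

lemma card_descents_le:
  fixes l r dl dr :: "nat \<Rightarrow> real"
  assumes lr: "\<And>i. i < M \<Longrightarrow> l i < r i" and sep: "\<And>i j. i < j \<Longrightarrow> j < M \<Longrightarrow> r i < l j"
    and dl: "\<And>i. i < M \<Longrightarrow> (potential has_real_derivative dl i) (at (l i))"
    and dr: "\<And>i. i < M \<Longrightarrow> (potential has_real_derivative dr i) (at (r i))"
    and e: "\<And>i. i < M \<Longrightarrow> dr i < e \<and> e < dl i"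
  shows "M \<le> card Q"
proof -
  define e1 where "e1 = Min (insert (e + 1) (dl ` {..<M}))"
  have e1: "e < e1" "\<And>i. i < M \<Longrightarrow> e1 \<le> dl i" using e unfolding e1_def by (auto simp: Min_le)
  define q where "q u i = (SOME q. l i < q \<and> q < r i \<and> (\<forall>x\<in>{l i..r i}. potential x - u * x \<le> potential q - u * q) \<and>
     potential (l i) - u * l i < potential q - u * q \<and> potential (r i) - u * r i < potential q - u * q)" for u i
  have q: "l i < q u i \<and> q u i < r i \<and> (\<forall>x\<in>{l i..r i}. potential x - u * x \<le> potential (q u i) - u * q u i) \<and>
     potential (l i) - u * l i < potential (q u i) - u * q u i \<and> potential (r i) - u * r i < potential (q u i) - u * q u i"
    if "i < M" "u \<in> {e<..<e1}" for u i
  proof -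
    have "dr i < u" using e[OF that(1)] that(2) by simp
    moreover have "u < dl i" using e1(2)[OF that(1)] that(2) by simp
    ultimately have "\<exists>q. l i < q \<and> q < r i \<and> (\<forall>x\<in>{l i..r i}. potential x - u * x \<le> potential q - u * q) \<and>
     potential (l i) - u * l i < potential q - u * q \<and> potential (r i) - u * r i < potential q - u * q"
      by (rule interior_maximum[OF lr[OF that(1)] dl[OF that(1)] dr[OF that(1)]])
    then show ?thesis unfolding q_def by (rule someI_ex)
  qed
  define m where "m u i = potential (q u i) - u * q u i" for u i
  \<comment> \<open>An envelope argument: the maximal value over an interval, as a function of the tilt, has slope minus
the maximiser. Maximisers in different intervals are ordered, so the difference of two maximal values is strictly
monotone and vanishes for at most one tilt.\<close>
  have incr: "m u i - m u j < m v i - m v j"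
    if ij: "i < j" "j < M" and uv: "u < v" "u \<in> {e<..<e1}" "v \<in> {e<..<e1}" for i j u v
  proof -
    have i: "i < M" using ij by simp
    have "potential (q u i) - v * q u i \<le> m v i" using q[OF i uv(3)] q[OF i uv(2)] by (simp add: m_def)
    moreover have "potential (q v j) - u * q v j \<le> m u j" using q[OF ij(2) uv(3)] q[OF ij(2) uv(2)] by (simp add: m_def)
    moreover have "q u i < q v j" using q[OF i uv(2)] q[OF ij(2) uv(3)] sep[OF ij] by linarith
    then have "(v - u) * q u i < (v - u) * q v j" using uv(1) by simp
    ultimately show ?thesis unfolding m_def[of v j] m_def[of u i] by (simp add: algebra_simps)
  qed
  define B where "B i j = {u \<in> {e<..<e1}. m u i = m u j}" for i j
  have "finite (B i j)" if "i < j" "j < M" for i j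
  proof -
    have "u = v" if "u \<in> B i j" "v \<in> B i j" for u v
      using incr[OF \<open>i < j\<close> \<open>j < M\<close>, of u v] incr[OF \<open>i < j\<close> \<open>j < M\<close>, of v u] that
      by (cases u v rule: linorder_cases) (auto simp: B_def)
    then have "B i j = {} \<or> (\<exists>u. B i j = {u})" by blast
    then show ?thesis by auto
  qed
  then have "finite (insert 0 (\<Union>j<M. \<Union>i<j. B i j))" by auto
  then have "infinite ({e<..<e1} - insert 0 (\<Union>j<M. \<Union>i<j. B i j))"
    using e1(1) by (intro Diff_infinite_finite) (auto simp: infinite_Ioo)
  then obtain u where "u \<in> {e<..<e1} - insert 0 (\<Union>j<M. \<Union>i<j. B i j)"
    using infinite_imp_nonempty by blast
  then have u: "u \<in> {e<..<e1}" "u \<noteq> 0" "\<And>i j. i < j \<Longrightarrow> j < M \<Longrightarrow> u \<notin> B i j" by auto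
  interpret charged_half_plane "extension u" Pos Neg u by (rule charged_half_plane[OF u(2)])
  have "card {..<M} \<le> card Pos + card Neg"
  proof (rule card_axis_maxima_le[where l = l and r = r and q = "q u" and c = "m u"])
    show "inj_on (m u) {..<M}"
    proof (rule linorder_inj_onI')
      fix i j assume "i \<in> {..<M}" "j \<in> {..<M}" "i < j"
      then show "m u i \<noteq> m u j" using u(1) u(3)[of i j] by (auto simp: B_def)
    qed
    show "r i \<le> l j" if "i \<in> {..<M}" "j \<in> {..<M}" "i < j" for i j
      using sep[of i j] that by simp
  qed (use q[OF _ u(1)] in \<open>auto simp: extension_axis m_def\<close>)
  also have "\<dots> \<le> card {q \<in> Q. \<zeta> q > 0} + card {q \<in> Q. \<zeta> q < 0}"
    unfolding Pos_def Neg_def by (intro add_mono card_image_le) (use finQ in auto)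
  also have "\<dots> = card ({q \<in> Q. \<zeta> q > 0} \<union> {q \<in> Q. \<zeta> q < 0})"
    by (rule card_Un_disjoint[symmetric]) (use finQ in auto)
  also have "\<dots> \<le> card Q" by (intro card_mono finQ) auto
  finally show ?thesis by simp
qed

end

section \<open>The potential is nowhere locally constant\<close>

lemma DERIV_line_kernel:
  assumes "(x, 0) \<noteq> (a, b)"
  shows "((\<lambda>x. ((x - a)\<^sup>2 + b\<^sup>2) powr - s) has_real_derivative
     - 2 * s * (x - a) * ((x - a)\<^sup>2 + b\<^sup>2) powr (- s - 1)) (at x)"
proof -
  have "(x - a)\<^sup>2 + b\<^sup>2 > 0" using assms by (auto simp: sum_power2_gt_zero_iff)
  from has_real_derivative_powr[OF this, of "- s"]
  have "((\<lambda>x. ((x - a)\<^sup>2 + b\<^sup>2) powr - s) has_real_derivative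
     - s * ((x - a)\<^sup>2 + b\<^sup>2) powr (- s - 1) * (2 * (x - a))) (at x)"
    by (rule DERIV_chain2) (auto intro!: derivative_eq_intros)
  then show ?thesis by (simp add: ac_simps)
qed

text \<open>The derivative of \<open>line_potential\<close> away from charges on the line. Its formula also makes sense at the
charges, which lets it be treated as a total function.\<close>

definition line_force :: "real \<Rightarrow> (real \<times> real) set \<Rightarrow> (real \<times> real \<Rightarrow> real) \<Rightarrow> real \<Rightarrow> real" where
  "line_force s Q \<zeta> x =
     (\<Sum>(a, b)\<in>Q. \<zeta> (a, b) * (- 2 * s * (x - a) * ((x - a)\<^sup>2 + b\<^sup>2) powr (- s - 1)))"

lemma DERIV_line_potential:
  assumes "(x, 0) \<notin> Q"
  shows "(line_potential s Q \<zeta> has_real_derivative line_force s Q \<zeta> x) (at x)"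
  unfolding line_potential_def[abs_def] line_force_def case_prod_unfold prod.collapse
proof (intro DERIV_sum DERIV_cmult)
  fix q assume "q \<in> Q"
  then show "((\<lambda>x. ((x - fst q)\<^sup>2 + (snd q)\<^sup>2) powr - s) has_real_derivative
    - 2 * s * (x - fst q) * ((x - fst q)\<^sup>2 + (snd q)\<^sup>2) powr (- s - 1)) (at x)"
    using assms by (intro DERIV_line_kernel) auto
qed

lemma powr_times_cnj:
  assumes "Re t > 0"
  shows "t powr of_real u * cnj t powr of_real u = of_real ((norm t ^ 2) powr u)"
proof -
  have t: "t \<noteq> 0" "t \<notin> \<real>\<^sub>\<le>\<^sub>0" using assms by (auto simp: complex_nonpos_Reals_iff)
  have "cnj t powr of_real u = cnj (t powr of_real u)"
    using cnj_powr[of t "of_real u"] assms by simp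
  then have "t powr of_real u * cnj t powr of_real u = of_real (norm (t powr of_real u) ^ 2)"
    by (simp only: complex_norm_square)
  also have "norm (t powr of_real u) = norm t powr u"
    using norm_powr_real_powr'[of "of_real u" t] by simp
  also have "(norm t powr u) ^ 2 = (norm t ^ 2) powr u"
    using t by (simp add: power2_eq_square powr_mult)
  finally show ?thesis .
qed

text \<open>The quotient differs from 1 by \<open>(z - x0) / (x0 - w)\<close>, which has norm less than 1.\<close>

lemma ball_quotient_Re_pos:
  fixes z w x0 :: complex
  assumes "dist x0 z < dist x0 w"
  shows "Re ((z - w) / (x0 - w)) > 0" "norm ((z - w) / (x0 - w)) < 2"
proof -
  have nz: "x0 \<noteq> w" using assms by auto
  have eq: "(z - w) / (x0 - w) = 1 + (z - x0) / (x0 - w)" using nz by (simp add: field_simps)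
  have lt: "norm ((z - x0) / (x0 - w)) < 1"
    using assms nz by (simp add: norm_divide dist_norm norm_minus_commute divide_less_eq)
  then have "\<bar>Re ((z - x0) / (x0 - w))\<bar> < 1" using abs_Re_le_cmod le_less_trans by blast
  then show "Re ((z - w) / (x0 - w)) > 0" unfolding eq plus_complex.sel one_complex.sel by linarith
  have "norm (1 + (z - x0) / (x0 - w)) \<le> 1 + norm ((z - x0) / (x0 - w))"
    using norm_triangle_ineq[of 1 "(z - x0) / (x0 - w)"] by simp
  then show "norm ((z - w) / (x0 - w)) < 2" unfolding eq using lt by linarith
qed

text \<open>The holomorphic continuation of \<open>((x - a)\<^sup>2 + b\<^sup>2) powr - s\<close> from a neighbourhood of \<open>x0\<close>. The factors are
normalised at \<open>x0\<close>, so that on the disc reaching up to the singularity \<open>w = a + \<i> * b\<close> both quotients stay in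
the right half plane, where the principal branch of the power is holomorphic.\<close>

definition kernel_branch :: "real \<Rightarrow> real \<Rightarrow> real \<times> real \<Rightarrow> complex \<Rightarrow> complex" where
  "kernel_branch s x0 q z = (let w = Complex (fst q) (snd q) in
     of_real ((dist (of_real x0) w)\<^sup>2 powr - s) *
     (((z - w) / (of_real x0 - w)) powr of_real (- s) *
      ((z - cnj w) / (of_real x0 - cnj w)) powr of_real (- s)))"

lemma dist_of_real_cnj: "dist (of_real x) (cnj w) = dist (of_real x) w"
  using complex_mod_cnj[of "of_real x - w"] by (simp add: dist_norm)

lemma kernel_branch_holomorphic:
  "kernel_branch s x0 q holomorphic_on ball (of_real x0) (dist (of_real x0) (Complex (fst q) (snd q)))"
proof -
  define w where "w = Complex (fst q) (snd q)"
  have "(z - w) / (of_real x0 - w) \<notin> \<real>\<^sub>\<le>\<^sub>0" "(z - cnj w) / (of_real x0 - cnj w) \<notin> \<real>\<^sub>\<le>\<^sub>0"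
      "of_real x0 \<noteq> w" "of_real x0 \<noteq> cnj w"
    if "z \<in> ball (of_real x0) (dist (of_real x0) w)" for z
  proof -
    have z: "dist (of_real x0) z < dist (of_real x0) w" "dist (of_real x0) z < dist (of_real x0) (cnj w)"
      using that dist_of_real_cnj[of x0 w] by auto
    have "t \<notin> \<real>\<^sub>\<le>\<^sub>0" if "Re t > 0" for t using that by (auto simp: complex_nonpos_Reals_iff)
    then show "(z - w) / (of_real x0 - w) \<notin> \<real>\<^sub>\<le>\<^sub>0" "(z - cnj w) / (of_real x0 - cnj w) \<notin> \<real>\<^sub>\<le>\<^sub>0"
      using ball_quotient_Re_pos(1) z by blast+
    show "of_real x0 \<noteq> w" "of_real x0 \<noteq> cnj w" using z zero_le_dist[of "of_real x0" z] by auto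
  qed
  then show ?thesis
    unfolding kernel_branch_def[abs_def] Let_def w_def[symmetric]
    by (intro holomorphic_intros) auto
qed

lemma kernel_branch_real:
  assumes "dist (of_real x0) (of_real x :: complex) < dist (of_real x0) (Complex a b)"
  shows "kernel_branch s x0 (a, b) (of_real x) = of_real (((x - a)\<^sup>2 + b\<^sup>2) powr - s)"
proof -
  define w where "w = Complex a b"
  have nz: "of_real x0 \<noteq> w" using assms by (auto simp: w_def)
  have n: "(norm (of_real y - w))\<^sup>2 = (y - a)\<^sup>2 + b\<^sup>2" for y by (simp add: w_def cmod_power2)
  define t where "t = (of_real x - w) / (of_real x0 - w)"
  have "Re t > 0" unfolding t_def by (rule ball_quotient_Re_pos) (use assms in \<open>simp add: w_def\<close>)
  from powr_times_cnj[OF this, of "- s"]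
  have "kernel_branch s x0 (a, b) (of_real x)
      = of_real ((dist (of_real x0) w)\<^sup>2 powr - s) * of_real ((norm t)\<^sup>2 powr - s)"
    unfolding kernel_branch_def Let_def fst_conv snd_conv w_def[symmetric] t_def by simp
  also have "\<dots> = of_real (((dist (of_real x0) w)\<^sup>2 * (norm t)\<^sup>2) powr - s)"
    by (simp add: powr_mult)
  also have "(dist (of_real x0) w)\<^sup>2 * (norm t)\<^sup>2 = (x - a)\<^sup>2 + b\<^sup>2"
    using nz n[of x] by (simp add: t_def norm_divide dist_norm power_divide)
  finally show ?thesis .
qed

text \<open>Along the radius towards \<open>w\<close> the first quotient is \<open>1 - t\<close>, and the second one is bounded by 2, also if \<open>b = 0\<close>
and both quotients agree.\<close>

lemma kernel_branch_blows_up: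
  assumes s: "s > 0" and nz: "of_real x0 \<noteq> Complex a b"
  shows "filterlim (\<lambda>t. norm (kernel_branch s x0 (a, b) (of_real x0 + of_real t * (Complex a b - of_real x0))))
    at_top (at_left 1)"
proof -
  define w where "w = Complex a b"
  define C where "C = (dist (of_real x0) w)\<^sup>2 powr - s * 2 powr - s"
  have C: "C > 0" using nz by (simp add: C_def w_def)
  have "filterlim (\<lambda>t :: real. 1 - t) (at_right 0) (at_left 1)"
  proof (rule tendsto_imp_filterlim_at_right)
    show "((\<lambda>t :: real. 1 - t) \<longlongrightarrow> 0) (at_left 1)" by (auto intro!: tendsto_eq_intros)
    show "\<forall>\<^sub>F t :: real in at_left 1. 0 < 1 - t" by (rule eventually_at_leftI[of 0]) auto
  qed
  then have "filterlim (\<lambda>t :: real. (1 - t) powr - s) at_top (at_left 1)"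
    by (rule filterlim_compose[rotated]) (use s in real_asymp)
  then have "filterlim (\<lambda>t :: real. C * (1 - t) powr - s) at_top (at_left 1)"
    using C by (intro filterlim_tendsto_pos_mult_at_top[OF tendsto_const])
  moreover have "\<forall>\<^sub>F t in at_left 1. C * (1 - t) powr - s \<le>
     norm (kernel_branch s x0 (a, b) (of_real x0 + of_real t * (w - of_real x0)))"
  proof (rule eventually_at_leftI[of 0])
    fix t :: real assume t: "t \<in> {0<..<1}"
    define z where "z = of_real x0 + of_real t * (w - of_real x0)"
    have "norm (of_real t * (w - of_real x0)) < norm (w - of_real x0)"
      using t nz by (simp add: norm_mult w_def)
    then have d: "dist (of_real x0) z < dist (of_real x0) w"
      by (simp add: z_def dist_norm norm_minus_commute)
    have q1: "(z - w) / (of_real x0 - w) = of_real (1 - t)"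
      using nz by (simp add: z_def w_def[symmetric] field_simps)
    define v where "v = (z - cnj w) / (of_real x0 - cnj w)"
    have v: "norm v < 2" "Re v > 0"
      unfolding v_def using ball_quotient_Re_pos[of "of_real x0" z "cnj w"] d by (auto simp: dist_of_real_cnj)
    then have "v \<noteq> 0" by auto
    have nv: "norm (v powr of_real (- s)) = norm v powr - s"
      using norm_powr_real_powr'[of "of_real (- s)" v] by simp
    have "norm (complex_of_real (1 - t) powr of_real (- s)) = norm (complex_of_real (1 - t)) powr - s"
      using norm_powr_real_powr'[of "of_real (- s)" "of_real (1 - t)"] by simp
    also have "norm (complex_of_real (1 - t)) = 1 - t" unfolding norm_of_real using t by simp
    finally have n1: "norm (complex_of_real (1 - t) powr of_real (- s)) = (1 - t) powr - s" .
    have "norm (kernel_branch s x0 (a, b) z)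
        = (dist (of_real x0) w)\<^sup>2 powr - s * ((1 - t) powr - s * norm v powr - s)"
      unfolding kernel_branch_def Let_def fst_conv snd_conv w_def[symmetric] q1 v_def[symmetric]
        norm_mult n1 nv norm_of_real by simp
    moreover have "2 powr - s \<le> norm v powr - s" using v \<open>v \<noteq> 0\<close> s by (intro powr_mono2') auto
    then have "(dist (of_real x0) w)\<^sup>2 powr - s * ((1 - t) powr - s * 2 powr - s)
       \<le> (dist (of_real x0) w)\<^sup>2 powr - s * ((1 - t) powr - s * norm v powr - s)"
      by (intro mult_left_mono) auto
    ultimately show "C * (1 - t) powr - s \<le> norm (kernel_branch s x0 (a, b) z)"
      unfolding C_def by (simp only: mult.assoc mult.commute mult.left_commute)
  qed auto
  ultimately show ?thesis unfolding w_def by (rule filterlim_at_top_mono)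
qed

text \<open>Two different singularities in the closed upper half plane have the same distance from at most one point of the line.\<close>

lemma exists_generic_point:
  fixes u v :: real
  assumes "finite Q" "\<And>a b. (a, b) \<in> Q \<Longrightarrow> 0 \<le> b" "u < v"
  shows "\<exists>x. u < x \<and> x < v \<and> (x, 0) \<notin> Q \<and>
    inj_on (\<lambda>q. dist (complex_of_real x) (Complex (fst q) (snd q))) Q"
proof -
  have d: "(dist (complex_of_real x) (Complex (fst q) (snd q)))\<^sup>2 = (x - fst q)\<^sup>2 + (snd q)\<^sup>2" for x q
    by (simp add: dist_norm cmod_power2)
  define B where "B q q' = {x. dist (complex_of_real x) (Complex (fst q) (snd q))
     = dist (complex_of_real x) (Complex (fst q') (snd q'))}" for q q'
  have finB: "finite (B q q')" if qq: "q \<in> Q" "q' \<in> Q" "q \<noteq> q'" for q q'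
  proof -
    have "2 * (fst q' - fst q) * x = (fst q')\<^sup>2 + (snd q')\<^sup>2 - (fst q)\<^sup>2 - (snd q)\<^sup>2" if "x \<in> B q q'" for x
    proof -
      have "(x - fst q)\<^sup>2 + (snd q)\<^sup>2 = (x - fst q')\<^sup>2 + (snd q')\<^sup>2"
        using that d[of x q] d[of x q'] by (simp add: B_def)
      then show ?thesis by (simp add: power2_eq_square algebra_simps)
    qed
    note lin = this
    show ?thesis
    proof (cases "fst q = fst q'")
      case True
      have "0 \<le> snd q" "0 \<le> snd q'" using assms(2) qq by (metis prod.collapse)+
      then have "(snd q')\<^sup>2 \<noteq> (snd q)\<^sup>2" using True qq(3) by (auto simp: prod_eq_iff)
      then have "B q q' = {}" using lin True by auto
      then show ?thesis by simp
    next
      case False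
      then have "B q q' \<subseteq> {((fst q')\<^sup>2 + (snd q')\<^sup>2 - (fst q)\<^sup>2 - (snd q)\<^sup>2) / (2 * (fst q' - fst q))}"
        using lin by (auto simp: eq_divide_eq mult.commute)
      then show ?thesis by (rule finite_subset) simp
    qed
  qed
  define Bad where "Bad = fst ` Q \<union> (\<Union>q\<in>Q. \<Union>q'\<in>Q - {q}. B q q')"
  have "finite Bad" unfolding Bad_def using assms(1) finB by auto
  then have "infinite ({u<..<v} - Bad)" using assms(3) by (intro Diff_infinite_finite) (auto simp: infinite_Ioo)
  then obtain x where x: "x \<in> {u<..<v} - Bad" using infinite_imp_nonempty by blast
  show ?thesis
  proof (intro exI[of _ x] conjI)
    have "x \<notin> fst ` Q" using x by (simp add: Bad_def)
    then show "(x, 0) \<notin> Q" by force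
    show "inj_on (\<lambda>q. dist (complex_of_real x) (Complex (fst q) (snd q))) Q"
    proof (rule inj_onI, rule ccontr)
      fix q q' assume "q \<in> Q" "q' \<in> Q" "q \<noteq> q'"
        "dist (complex_of_real x) (Complex (fst q) (snd q)) = dist (complex_of_real x) (Complex (fst q') (snd q'))"
      then have "x \<in> Bad" unfolding Bad_def B_def by blast
      then show False using x by blast
    qed
  qed (use x in auto)
qed

text \<open>If the derivative vanished on an interval, then near a generic \<open>x0\<close> the kernel with the singularity nearest
to \<open>x0\<close> would be a constant minus the other terms, which are all holomorphic on a larger disc. By the identity
theorem this relation persists on the disc up to the nearest singularity, where the left-hand side is unbounded
and the right-hand side is not.\<close>

lemma line_potential_not_locally_constant:
  assumes s: "s > 0" and Q: "finite Q" "Q \<noteq> {}" "\<And>a b. (a, b) \<in> Q \<Longrightarrow> 0 \<le> b"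
    and nonzero: "\<And>q. q \<in> Q \<Longrightarrow> \<zeta> q \<noteq> 0" and uv: "u < v"
  shows "\<exists>y. u < y \<and> y < v \<and> (y, 0) \<notin> Q \<and> line_force s Q \<zeta> y \<noteq> 0"
proof (rule ccontr)
  assume "\<not> ?thesis"
  then have flat: "line_force s Q \<zeta> y = 0" if "u < y" "y < v" "(y, 0) \<notin> Q" for y
    using that by blast
  obtain x0 where x0: "u < x0" "x0 < v" "(x0, 0) \<notin> Q"
    "inj_on (\<lambda>q. dist (complex_of_real x0) (Complex (fst q) (snd q))) Q"
    using exists_generic_point[of Q u v] Q(1,3) uv by metis
  define D where "D q = dist (complex_of_real x0) (Complex (fst q) (snd q))" for q
  define q1 where "q1 = arg_min_on D Q"
  have q1: "q1 \<in> Q" "\<And>q. q \<in> Q \<Longrightarrow> D q1 \<le> D q"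
    using arg_min_if_finite[OF Q(1,2), of D] unfolding q1_def by (auto simp: not_less)
  have closer: "D q1 < D q" if "q \<in> Q - {q1}" for q
  proof -
    have "D q1 \<noteq> D q" using x0(4) q1(1) that unfolding D_def inj_on_def by blast
    then show ?thesis using q1(2)[of q] that by simp
  qed
  have D_pos: "D q1 > 0"
    using x0(3) q1(1) by (cases q1) (auto simp: D_def complex_eq_iff)
  define W where "W = Complex (fst q1) (snd q1)"
  let ?E = "kernel_branch s x0"
  have "open (- fst ` {q \<in> Q. snd q = 0})" using Q(1) by (intro open_Compl finite_imp_closed) auto
  moreover have "x0 \<in> - fst ` {q \<in> Q. snd q = 0}" using x0(3) by force
  ultimately obtain \<rho>1 where r1: "\<rho>1 > 0" "ball x0 \<rho>1 \<subseteq> - fst ` {q \<in> Q. snd q = 0}"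
    using open_contains_ball by blast
  define \<rho> where "\<rho> = min (min \<rho>1 (D q1)) (min (x0 - u) (v - x0))"
  have \<rho>: "\<rho> > 0" using r1(1) D_pos x0 by (simp add: \<rho>_def)
  have near: "u < y \<and> y < v \<and> (y, 0) \<notin> Q \<and> dist x0 y < D q1" if "y \<in> ball x0 \<rho>" for y
  proof -
    have "\<bar>x0 - y\<bar> < \<rho>1" "\<bar>x0 - y\<bar> < D q1" "\<bar>x0 - y\<bar> < x0 - u" "\<bar>x0 - y\<bar> < v - x0"
      using that by (auto simp: \<rho>_def dist_real_def)
    moreover from this(1) have "y \<in> - fst ` {q \<in> Q. snd q = 0}" using r1(2) by (auto simp: dist_real_def)
    then have "(y, 0) \<notin> Q" by force
    ultimately show ?thesis by (auto simp: dist_real_def)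
  qed
  have "\<exists>c. \<forall>y\<in>ball x0 \<rho>. line_potential s Q \<zeta> y = c"
  proof (rule has_field_derivative_zero_constant)
    show "(line_potential s Q \<zeta> has_real_derivative 0) (at y within ball x0 \<rho>)" if "y \<in> ball x0 \<rho>" for y
      using DERIV_line_potential[of y Q s \<zeta>] near[OF that] flat[of y] by (auto intro: DERIV_subset)
  qed simp
  then obtain c where c: "\<And>y. y \<in> ball x0 \<rho> \<Longrightarrow> line_potential s Q \<zeta> y = c" by blast
  define F where "F z = (\<Sum>q\<in>Q. of_real (\<zeta> q) * ?E q z) - of_real c" for z
  have holo: "?E q holomorphic_on ball (of_real x0) (D q)" for q
    unfolding D_def by (rule kernel_branch_holomorphic)
  have F0: "F z = 0" if "z \<in> ball (of_real x0) (D q1)" for z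
  proof (rule analytic_continuation[of F "ball (of_real x0) (D q1)" "of_real ` ball x0 \<rho>" "of_real x0"])
    have "?E q holomorphic_on ball (of_real x0) (D q1)" if "q \<in> Q" for q
      using holo q1(2)[OF that] holomorphic_on_subset subset_ball by blast
    then show "F holomorphic_on ball (of_real x0) (D q1)"
      unfolding F_def by (intro holomorphic_intros)
    show "of_real ` ball x0 \<rho> \<subseteq> ball (of_real x0 :: complex) (D q1)"
      using near by (auto simp: dist_real_def dist_norm simp flip: of_real_diff)
    show "complex_of_real x0 islimpt complex_of_real ` ball x0 \<rho>"
      unfolding islimpt_approachable
    proof (intro allI impI)
      fix \<epsilon> :: real assume "\<epsilon> > 0"
      define y where "y = x0 + min \<rho> \<epsilon> / 2"
      have "y \<in> ball x0 \<rho>" "y \<noteq> x0" "\<bar>y - x0\<bar> < \<epsilon>" using \<rho> \<open>\<epsilon> > 0\<close> by (auto simp: y_def dist_real_def min_def)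
      then show "\<exists>x'\<in>complex_of_real ` ball x0 \<rho>. x' \<noteq> complex_of_real x0 \<and> dist x' (of_real x0) < \<epsilon>"
        by (intro bexI[of _ "of_real y"]) (auto simp: dist_norm simp flip: of_real_diff)
    qed
    show "F z = 0" if z: "z \<in> complex_of_real ` ball x0 \<rho>" for z
    proof -
      obtain y where y: "z = of_real y" "y \<in> ball x0 \<rho>" using z by blast
      have "?E q z = of_real (((y - fst q)\<^sup>2 + (snd q)\<^sup>2) powr - s)" if "q \<in> Q" for q
      proof -
        have "dist (of_real x0) (of_real y :: complex) = dist x0 y"
          by (simp add: dist_norm flip: of_real_diff)
        then have "dist (of_real x0) (of_real y :: complex) < dist (of_real x0) (Complex (fst q) (snd q))"
          using near[OF y(2)] q1(2)[OF that] by (simp add: D_def)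
        from kernel_branch_real[OF this] show ?thesis by (simp add: y(1))
      qed
      then have "F z = of_real (line_potential s Q \<zeta> y) - of_real c"
        by (simp add: F_def line_potential_def case_prod_unfold)
      then show ?thesis using c[OF y(2)] by simp
    qed
  qed (use D_pos that in auto)
  define p where "p t = complex_of_real x0 + of_real t * (W - of_real x0)" for t
  have p_lim: "(p \<longlongrightarrow> W) (at_left 1)" unfolding p_def by (auto intro!: tendsto_eq_intros)
  have "((\<lambda>t. (of_real c - (\<Sum>q\<in>Q - {q1}. of_real (\<zeta> q) * ?E q (p t))) / of_real (\<zeta> q1)) \<longlongrightarrow>
    (of_real c - (\<Sum>q\<in>Q - {q1}. of_real (\<zeta> q) * ?E q W)) / of_real (\<zeta> q1)) (at_left 1)"
  proof (intro tendsto_intros)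
    fix q assume q: "q \<in> Q - {q1}"
    have "W \<in> ball (of_real x0) (D q)" using closer[OF q] by (simp add: W_def D_def)
    then have "isCont (?E q) W"
      using holomorphic_on_imp_continuous_on[OF holo[of q]] continuous_on_eq_continuous_at[OF open_ball] by blast
    then show "((\<lambda>t. ?E q (p t)) \<longlongrightarrow> ?E q W) (at_left 1)"
      using p_lim by (rule isCont_tendsto_compose)
  qed (use nonzero q1(1) in auto)
  then have lim: "((\<lambda>t. norm ((of_real c - (\<Sum>q\<in>Q - {q1}. of_real (\<zeta> q) * ?E q (p t))) / of_real (\<zeta> q1))) \<longlongrightarrow>
    norm ((of_real c - (\<Sum>q\<in>Q - {q1}. of_real (\<zeta> q) * ?E q W)) / of_real (\<zeta> q1))) (at_left 1)"
    by (rule tendsto_norm)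
  have "\<forall>\<^sub>F t in at_left 1. norm (?E q1 (p t)) =
     norm ((of_real c - (\<Sum>q\<in>Q - {q1}. of_real (\<zeta> q) * ?E q (p t))) / of_real (\<zeta> q1))"
  proof (rule eventually_at_leftI[of 0])
    fix t :: real assume t: "t \<in> {0<..<1}"
    have "norm (of_real t * (W - of_real x0)) < norm (W - of_real x0)"
      using t D_pos by (simp add: norm_mult D_def W_def dist_norm norm_minus_commute)
    then have "p t \<in> ball (of_real x0) (D q1)"
      by (simp add: p_def D_def W_def dist_norm norm_minus_commute)
    from F0[OF this] have "of_real (\<zeta> q1) * ?E q1 (p t) = of_real c - (\<Sum>q\<in>Q - {q1}. of_real (\<zeta> q) * ?E q (p t))"
      by (simp add: F_def sum.remove[OF Q(1) q1(1)] algebra_simps)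
    then have "?E q1 (p t) = (of_real c - (\<Sum>q\<in>Q - {q1}. of_real (\<zeta> q) * ?E q (p t))) / of_real (\<zeta> q1)"
      using nonzero[OF q1(1)] by (simp add: eq_divide_eq mult.commute)
    then show "norm (?E q1 (p t)) = norm ((of_real c - (\<Sum>q\<in>Q - {q1}. of_real (\<zeta> q) * ?E q (p t))) / of_real (\<zeta> q1))"
      by simp
  qed simp
  then have "((\<lambda>t. norm (?E q1 (p t))) \<longlongrightarrow>
    norm ((of_real c - (\<Sum>q\<in>Q - {q1}. of_real (\<zeta> q) * ?E q W)) / of_real (\<zeta> q1))) (at_left 1)"
    using lim by (subst tendsto_cong)
  moreover have "filterlim (\<lambda>t. norm (?E q1 (p t))) at_top (at_left 1)"
    using kernel_branch_blows_up[OF s, of x0 "fst q1" "snd q1"] D_pos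
    unfolding p_def W_def by (simp add: D_def)
  ultimately show False
    using not_tendsto_and_filterlim_at_infinity[OF trivial_limit_at_left_real]
      filterlim_at_top_imp_at_infinity by blast
qed

section \<open>Counting critical points on the line\<close>

lemma finite_increasing_enumeration:
  fixes S :: "'a :: linorder set"
  assumes "finite S"
  obtains h where "h ` {..<card S} = S" "\<And>i j. i < j \<Longrightarrow> j < card S \<Longrightarrow> h i < h j"
proof (rule that[of "\<lambda>i. sorted_list_of_set S ! i"])
  show "(\<lambda>i. sorted_list_of_set S ! i) ` {..<card S} = S"
    using assms nth_image[of "card S" "sorted_list_of_set S"] by (simp add: lessThan_atLeast0)
  show "sorted_list_of_set S ! i < sorted_list_of_set S ! j" if "i < j" "j < card S" for i j
    using sorted_wrt_nth_less[OF strict_sorted_list_of_set[of S] that(1)] that(2) by simp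
qed

lemma line_force_at_top:
  assumes "s > 0"
  shows "(line_force s Q \<zeta> \<longlongrightarrow> 0) at_top"
proof -
  have "((\<lambda>x. \<zeta> q * (- 2 * s * (x - fst q) * ((x - fst q)\<^sup>2 + (snd q)\<^sup>2) powr (- s - 1))) \<longlongrightarrow> 0) at_top" for q
    using assms by real_asymp
  then have "((\<lambda>x. \<Sum>q\<in>Q. \<zeta> q * (- 2 * s * (x - fst q) * ((x - fst q)\<^sup>2 + (snd q)\<^sup>2) powr (- s - 1)))
      \<longlongrightarrow> (\<Sum>q\<in>Q. 0)) at_top" by (intro tendsto_sum)
  then show ?thesis by (simp add: line_force_def[abs_def] case_prod_unfold)
qed

text \<open>Charges on the line are replaced by charges at a small height \<open>\<delta>\<close>. The derivative at the
finitely many points \<open>l i\<close> and \<open>r i\<close> depends continuously on \<open>\<delta>\<close>, so the strict inequalities survive.\<close>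

lemma card_descents_le_on_axis:
  fixes l r :: "nat \<Rightarrow> real"
  assumes s: "s > 0" and Q: "finite Q" "\<And>q. q \<in> Q \<Longrightarrow> 0 \<le> snd q" and nonzero: "\<And>q. q \<in> Q \<Longrightarrow> \<zeta> q \<noteq> 0"
    and lr: "\<And>i. i < M \<Longrightarrow> l i < r i" and sep: "\<And>i j. i < j \<Longrightarrow> j < M \<Longrightarrow> r i < l j"
    and dom: "\<And>i. i < M \<Longrightarrow> (l i, 0) \<notin> Q \<and> (r i, 0) \<notin> Q"
    and e: "\<And>i. i < M \<Longrightarrow> line_force s Q \<zeta> (r i) < e \<and> e < line_force s Q \<zeta> (l i)"
  shows "M \<le> card Q"
proof -
  define \<phi> where "\<phi> \<delta> q = (fst q, if snd q = 0 then \<delta> else snd q)" for \<delta> and q :: "real \<times> real"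
  define G where "G \<delta> x = (\<Sum>q\<in>Q. \<zeta> q * (- 2 * s * (x - fst q) * ((x - fst q)\<^sup>2 + (snd (\<phi> \<delta> q))\<^sup>2) powr (- s - 1)))" for \<delta> x
  have lim: "((\<lambda>\<delta>. G \<delta> x) \<longlongrightarrow> line_force s Q \<zeta> x) (at_right 0)" if "(x, 0) \<notin> Q" for x
    unfolding line_force_def case_prod_unfold prod.collapse G_def
  proof (rule tendsto_sum)
    fix q assume "q \<in> Q"
    then have nz: "(x - fst q)\<^sup>2 + (snd q)\<^sup>2 \<noteq> 0" using that by (cases q) (auto simp: sum_power2_eq_zero_iff)
    have "((\<lambda>\<delta>. snd (\<phi> \<delta> q)) \<longlongrightarrow> snd q) (at_right 0)"
      by (cases "snd q = 0") (auto simp: \<phi>_def)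
    then show "((\<lambda>\<delta>. \<zeta> q * (- 2 * s * (x - fst q) * ((x - fst q)\<^sup>2 + (snd (\<phi> \<delta> q))\<^sup>2) powr (- s - 1)))
      \<longlongrightarrow> \<zeta> q * (- 2 * s * (x - fst q) * ((x - fst q)\<^sup>2 + (snd q)\<^sup>2) powr (- s - 1))) (at_right 0)"
      by (intro tendsto_mult tendsto_powr tendsto_add tendsto_power tendsto_const nz)
  qed
  have "\<forall>\<^sub>F \<delta> in at_right 0. \<forall>i\<in>{..<M}. G \<delta> (r i) < e \<and> e < G \<delta> (l i)"
  proof (intro eventually_ball_finite ballI eventually_conj)
    fix i assume "i \<in> {..<M}"
    then have i: "i < M" by simp
    show "\<forall>\<^sub>F \<delta> in at_right 0. G \<delta> (r i) < e"
      using order_tendstoD(2)[OF lim] dom[OF i] e[OF i] by blast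
    show "\<forall>\<^sub>F \<delta> in at_right 0. e < G \<delta> (l i)"
      using order_tendstoD(1)[OF lim] dom[OF i] e[OF i] by blast
  qed simp
  moreover have "\<forall>\<^sub>F \<delta> :: real in at_right 0. \<delta> > 0" by (rule eventually_at_right_less)
  moreover have "\<forall>\<^sub>F \<delta> in at_right 0. \<delta> \<notin> snd ` Q"
  proof -
    have "open (- (snd ` Q - {0}))" using Q(1) by (intro open_Compl finite_imp_closed) auto
    then have "\<forall>\<^sub>F \<delta> in nhds 0. \<delta> \<in> - (snd ` Q - {0})" by (intro eventually_nhds_in_open) auto
    then show ?thesis unfolding eventually_at_filter by eventually_elim auto
  qed
  ultimately have "\<forall>\<^sub>F \<delta> in at_right 0. (\<forall>i\<in>{..<M}. G \<delta> (r i) < e \<and> e < G \<delta> (l i)) \<and> \<delta> > 0 \<and> \<delta> \<notin> snd ` Q"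
    by (intro eventually_conj)
  then obtain \<delta> where \<delta>: "\<forall>i\<in>{..<M}. G \<delta> (r i) < e \<and> e < G \<delta> (l i)" "\<delta> > 0" "\<delta> \<notin> snd ` Q"
    using eventually_happens'[OF trivial_limit_at_right_real] by blast
  define Q' \<zeta>' where "Q' = \<phi> \<delta> ` Q" and "\<zeta>' = \<zeta> \<circ> inv_into Q (\<phi> \<delta>)"
  have inj: "inj_on (\<phi> \<delta>) Q"
  proof (rule inj_onI)
    fix p q assume pq: "p \<in> Q" "q \<in> Q" "\<phi> \<delta> p = \<phi> \<delta> q"
    then have "snd p \<noteq> \<delta>" "snd q \<noteq> \<delta>" using \<delta>(3) by auto
    then show "p = q" using pq(3) by (auto simp: \<phi>_def prod_eq_iff split: if_splits)
  qed
  have pos: "b > 0" if ab: "(a, b) \<in> Q'" for a b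
  proof -
    obtain q where q: "q \<in> Q" "b = (if snd q = 0 then \<delta> else snd q)"
      using ab by (auto simp: Q'_def \<phi>_def)
    then show ?thesis using Q(2)[OF q(1)] \<delta>(2) by (cases "snd q = 0") simp_all
  qed
  interpret ring_charges s Q' \<zeta>'
  proof
    show "\<zeta>' q \<noteq> 0" if "q \<in> Q'" for q
      using that nonzero inj by (auto simp: Q'_def \<zeta>'_def)
    show "s > 0" "finite Q'" using s Q(1) by (auto simp: Q'_def)
    show "b > 0" if "(a, b) \<in> Q'" for a b using that by (rule pos)
  qed
  have "line_force s Q' \<zeta>' x = G \<delta> x" for x
  proof -
    have "\<zeta>' (\<phi> \<delta> q) = \<zeta> q" "fst (\<phi> \<delta> q) = fst q" if "q \<in> Q" for q
      unfolding \<zeta>'_def comp_def inv_into_f_f[OF inj that] by (simp_all add: \<phi>_def)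
    then show ?thesis
      unfolding line_force_def G_def Q'_def case_prod_unfold prod.collapse
      by (subst sum.reindex[OF inj]) (intro sum.cong refl, simp)
  qed
  moreover have "(line_potential s Q' \<zeta>' has_real_derivative line_force s Q' \<zeta>' x) (at x)" for x
    by (rule DERIV_line_potential) (use pos in blast)
  ultimately have d: "(line_potential s Q' \<zeta>' has_real_derivative G \<delta> x) (at x)" for x by simp
  have "M \<le> card Q'"
    by (rule card_descents_le[where l = l and r = r and dl = "\<lambda>i. G \<delta> (l i)" and dr = "\<lambda>i. G \<delta> (r i)" and e = e])
       (use lr sep d \<delta>(1) in auto)
  also have "\<dots> = card Q" unfolding Q'_def by (rule card_image[OF inj])
  finally show ?thesis .
qed

text \<open>The \<open>y k\<close> are points in the gaps left by the zeros \<open>x i\<close>. A gap point with positive derivative, followed by the zero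
on its right, is a descent through every small level \<open>e > 0\<close>. The last gap has no zero on its right; there a far point
takes this part, as the derivative tends to 0 at infinity.\<close>

lemma card_positive_gaps_le:
  fixes x y :: "nat \<Rightarrow> real"
  assumes s: "s > 0" and Q: "finite Q" "\<And>q. q \<in> Q \<Longrightarrow> 0 \<le> snd q" and nonzero: "\<And>q. q \<in> Q \<Longrightarrow> \<zeta> q \<noteq> 0"
    and x: "\<And>i. i < m \<Longrightarrow> (x i, 0) \<notin> Q \<and> line_force s Q \<zeta> (x i) = 0"
    and x_mono: "\<And>i j. i \<le> j \<Longrightarrow> j < m \<Longrightarrow> x i \<le> x j"
    and y: "\<And>k. k \<le> m \<Longrightarrow> (y k, 0) \<notin> Q"
    and y_below: "\<And>k. k < m \<Longrightarrow> y k < x k" and y_above: "\<And>k. k < m \<Longrightarrow> x k < y (Suc k)"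
    and K: "K \<subseteq> {..m}" "\<And>k. k \<in> K \<Longrightarrow> 0 < line_force s Q \<zeta> (y k)"
  shows "card K \<le> card Q"
proof -
  have finK: "finite K" using K(1) finite_subset by blast
  obtain h where h: "h ` {..<card K} = K" "\<And>i j. i < j \<Longrightarrow> j < card K \<Longrightarrow> h i < h j"
    using finite_increasing_enumeration[OF finK] by blast
  have hK: "h i \<in> K" "h i \<le> m" if "i < card K" for i using h(1) K(1) that by auto
  define e where "e = Min (insert 1 ((\<lambda>k. line_force s Q \<zeta> (y k)) ` K)) / 2"
  have "0 < Min (insert 1 ((\<lambda>k. line_force s Q \<zeta> (y k)) ` K))" using finK K(2) by (subst Min_gr_iff) auto
  then have e0: "0 < e" by (simp add: e_def)
  have e: "e < line_force s Q \<zeta> (y k)" if "k \<in> K" for k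
  proof -
    have "Min (insert 1 ((\<lambda>k. line_force s Q \<zeta> (y k)) ` K)) \<le> line_force s Q \<zeta> (y k)"
      using finK that by (intro Min_le) auto
    then show ?thesis using e0 unfolding e_def by linarith
  qed
  have "\<forall>\<^sub>F t in at_top. line_force s Q \<zeta> t < e"
    by (rule order_tendstoD(2)[OF line_force_at_top[OF s] e0])
  moreover have "\<forall>\<^sub>F t in at_top. y m < t" by (rule eventually_gt_at_top)
  moreover have "\<forall>\<^sub>F t in at_top. (t, 0) \<notin> Q"
  proof (rule eventually_mono[OF eventually_gt_at_top[of "Max (insert 0 (fst ` Q))"]])
    fix t assume t: "Max (insert 0 (fst ` Q)) < t"
    show "(t, 0) \<notin> Q"
    proof
      assume "(t, 0) \<in> Q"
      then have "t \<le> Max (insert 0 (fst ` Q))" using Q(1) by (intro Max_ge) force+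
      then show False using t by simp
    qed
  qed
  ultimately have "\<forall>\<^sub>F t in at_top. line_force s Q \<zeta> t < e \<and> y m < t \<and> (t, 0) \<notin> Q"
    by (intro eventually_conj)
  then obtain T where T: "line_force s Q \<zeta> T < e" "y m < T" "(T, 0) \<notin> Q"
    using eventually_happens'[OF trivial_limit_at_top_linorder] by blast
  define r where "r i = (if h i < m then x (h i) else T)" for i
  show ?thesis
  proof (rule card_descents_le_on_axis[where l = "\<lambda>i. y (h i)" and r = r and e = e, OF s Q nonzero])
    show "y (h i) < r i" if "i < card K" for i
      using hK[OF that] y_below T(2) by (cases "h i < m") (auto simp: r_def)
    show "r i < y (h j)" if ij: "i < j" "j < card K" for i j
    proof -
      have "h i < h j" "h j \<le> m" using h(2)[OF ij] hK[OF ij(2)] by auto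
      then obtain k where k: "h j = Suc k" "h i \<le> k" "k < m" by (cases "h j") auto
      then have "x (h i) \<le> x k" "x k < y (h j)" using x_mono y_above[OF k(3)] by auto
      then show ?thesis using k by (simp add: r_def)
    qed
    show "(y (h i), 0) \<notin> Q \<and> (r i, 0) \<notin> Q" if "i < card K" for i
      using hK[OF that] y x T(3) by (auto simp: r_def)
    show "line_force s Q \<zeta> (r i) < e \<and> e < line_force s Q \<zeta> (y (h i))" if "i < card K" for i
      using e[OF hK(1)[OF that]] x T(1) e0 by (auto simp: r_def)
  qed
qed

lemma line_force_uminus: "line_force s Q (\<lambda>q. - \<zeta> q) x = - line_force s Q \<zeta> x"
  by (simp add: line_force_def case_prod_unfold sum_negf)

text \<open>If there are \<open>m\<close> zeros, then each of the \<open>m + 1\<close> gaps contains a point with nonzero derivative. At most \<open>card Q\<close>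
of these derivatives are positive and, by the same bound for \<open>- \<zeta>\<close>, at most \<open>card Q\<close> are negative.\<close>

lemma card_zeros_line_force:
  assumes s: "s > 0" and Q: "finite Q" "Q \<noteq> {}" "\<And>q. q \<in> Q \<Longrightarrow> 0 \<le> snd q"
    and nonzero: "\<And>q. q \<in> Q \<Longrightarrow> \<zeta> q \<noteq> 0"
  defines "C \<equiv> {x. (x, 0) \<notin> Q \<and> line_force s Q \<zeta> x = 0}"
  shows "finite C \<and> card C \<le> 2 * card Q - 1"
proof -
  have bound: "card X < 2 * card Q" if X: "finite X" "X \<subseteq> C" for X
  proof (cases "X = {}")
    case True
    then show ?thesis using Q by (simp add: card_gt_0_iff)
  next
    case False
    define m where "m = card X"
    have m: "m > 0" using False X by (simp add: m_def card_gt_0_iff)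
    obtain x where x: "x ` {..<m} = X" "\<And>i j. i < j \<Longrightarrow> j < m \<Longrightarrow> x i < x j"
      using finite_increasing_enumeration[OF X(1)] unfolding m_def by blast
    \<comment> \<open>The two unbounded gaps are cut down to length 1.\<close>
    define lo hi where "lo k = (if k = 0 then x 0 - 1 else x (k - 1))"
      and "hi k = (if k < m then x k else x (m - 1) + 1)" for k
    have "\<exists>y. lo k < y \<and> y < hi k \<and> (y, 0) \<notin> Q \<and> line_force s Q \<zeta> y \<noteq> 0" if "k \<le> m" for k
    proof (rule line_potential_not_locally_constant[OF s Q(1,2) _ nonzero])
      show "lo k < hi k"
        using that x(2)[of "k - 1" k] m by (cases "k = 0"; cases "k = m") (auto simp: lo_def hi_def)
    qed (use Q(3) in force)+
    then obtain y where y: "\<And>k. k \<le> m \<Longrightarrow> lo k < y k \<and> y k < hi k \<and> (y k, 0) \<notin> Q \<and> line_force s Q \<zeta> (y k) \<noteq> 0"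
      by metis
    define P where "P = {k \<in> {..m}. 0 < line_force s Q \<zeta> (y k)}"
    define P' where "P' = {k \<in> {..m}. line_force s Q \<zeta> (y k) < 0}"
    have zero: "(x i, 0) \<notin> Q \<and> line_force s Q \<zeta> (x i) = 0" if "i < m" for i
      using x(1) X(2) that by (auto simp: C_def)
    have mono: "x i \<le> x j" if "i \<le> j" "j < m" for i j
      using x(2)[of i j] that by (cases "i = j") auto
    have below: "y k < x k" and above: "x k < y (Suc k)" if "k < m" for k
      using y[of k] y[of "Suc k"] that by (auto simp: lo_def hi_def)
    have "card P \<le> card Q"
    proof (rule card_positive_gaps_le[where x = x and y = y and m = m and \<zeta> = \<zeta>, OF s Q(1,3) nonzero zero mono])
      show "(y k, 0) \<notin> Q" if "k \<le> m" for k using y[OF that] by blast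
    qed (use below above in \<open>auto simp: P_def\<close>)
    moreover have "card P' \<le> card Q"
    proof (rule card_positive_gaps_le[where x = x and y = y and m = m and \<zeta> = "\<lambda>q. - \<zeta> q", OF s Q(1,3)])
      show "(x i, 0) \<notin> Q \<and> line_force s Q (\<lambda>q. - \<zeta> q) (x i) = 0" if "i < m" for i
        using zero[OF that] by (simp add: line_force_uminus)
      show "(y k, 0) \<notin> Q" if "k \<le> m" for k using y[OF that] by blast
      show "x i \<le> x j" if "i \<le> j" "j < m" for i j using mono that by blast
    qed (use below above nonzero in \<open>auto simp: P'_def line_force_uminus\<close>)
    moreover have "{..m} = P \<union> P'" using y by (auto simp: P_def P'_def neq_iff)
    then have "m + 1 = card (P \<union> P')" by (metis Suc_eq_plus1 card_atMost)
    moreover have "card (P \<union> P') \<le> card P + card P'" by (rule card_Un_le)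
    ultimately show ?thesis by (simp add: m_def)
  qed
  have "finite C"
  proof (rule ccontr)
    assume "infinite C"
    then obtain X where "X \<subseteq> C" "finite X" "card X = 2 * card Q"
      using infinite_arbitrarily_large by blast
    then show False using bound[of X] by simp
  qed
  then show ?thesis using bound[of C] by simp
qed

section \<open>Restriction of the spatial potential to the line\<close>

text \<open>The foot of the perpendicular realises \<open>infdist\<close>, and \<open>c\<close> preserves distances within \<open>L\<close>.\<close>

lemma pythagoras_projection:
  assumes "affine_line L" "isometric_affine_coordinate L c" "X \<in> L"
  shows "(norm (X - P))\<^sup>2 = (c X - axial_coord L c P)\<^sup>2 + (infdist P L)\<^sup>2"
proof -
  have aff: "affine L" "L \<noteq> {}" using assms(1,3) by (auto simp: affine_line_def)
  define F where "F = orthogonal_projection L P"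
  have F: "F \<in> L" unfolding F_def by (rule orthogonal_projection(1)[OF aff])
  have pyth: "(dist P Y)\<^sup>2 = (dist P F)\<^sup>2 + (dist F Y)\<^sup>2" if "Y \<in> L" for Y
  proof -
    have "orthogonal (P - F) (F - Y)"
      using orthogonal_projection(2)[OF aff that, of P] unfolding F_def[symmetric]
      by (simp add: orthogonal_def inner_diff_right)
    from norm_add_Pythagorean[OF this] show ?thesis by (simp add: dist_norm)
  qed
  have "dist P F \<le> dist P Y" if "Y \<in> L" for Y
    using pyth[OF that] by (intro power2_le_imp_le[of "dist P F"]) auto
  then have "dist P F \<le> infdist P L" unfolding infdist_notempty[OF aff(2)] by (intro cINF_greatest[OF aff(2)])
  then have "infdist P L = dist P F" using infdist_le[OF F, of P] by simp
  moreover have "dist (c X) (c F) = dist X F"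
    using assms(2,3) F unfolding isometric_affine_coordinate_def by blast
  then have "\<bar>c X - axial_coord L c P\<bar> = dist F X"
    by (simp add: axial_coord_def F_def dist_real_def dist_commute)
  then have "(c X - axial_coord L c P)\<^sup>2 = (dist F X)\<^sup>2"
    using power2_abs[of "c X - axial_coord L c P"] by simp
  moreover have "norm (X - P) = dist P X" by (simp add: dist_norm norm_minus_commute)
  ultimately show ?thesis using pyth[OF assms(3)] by simp
qed

lemma point_charge_potential_on_line:
  assumes "affine_line L" "isometric_affine_coordinate L c" "X \<in> L"
  shows "point_charge_potential p n A \<zeta> X = (\<Sum>j = 1..n. \<zeta> j *
     ((c X - axial_coord L c (A j))\<^sup>2 + (infdist (A j) L)\<^sup>2) powr (- p / 2))"
  unfolding point_charge_potential_def
proof (rule sum.cong)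
  fix j
  have "(t\<^sup>2) powr (- p / 2) = 1 / t powr p" if "t \<ge> 0" for t :: real
  proof (cases "t = 0")
    case False
    then have "t\<^sup>2 = t powr 2" using that by (simp add: powr_numeral)
    then show ?thesis by (simp add: powr_powr powr_minus_divide)
  qed simp
  then have "((norm (X - A j))\<^sup>2) powr (- p / 2) = 1 / norm (X - A j) powr p" by simp
  then show "\<zeta> j / norm (X - A j) powr p =
     \<zeta> j * ((c X - axial_coord L c (A j))\<^sup>2 + (infdist (A j) L)\<^sup>2) powr (- p / 2)"
    using pythagoras_projection[OF assms, of "A j"] by simp
qed simp

lemma restricted_potential_combines:
  "restricted_potential p L c n A \<zeta> x = (\<Sum>j = 1..n. \<zeta> j *
     ((x - axial_coord L c (A j))\<^sup>2 + (infdist (A j) L)\<^sup>2) powr (- p / 2))"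
proof -
  let ?pair = "\<lambda>j. induced_pair L c (A j)"
  let ?k = "\<lambda>q. ((x - fst q)\<^sup>2 + (snd q)\<^sup>2) powr (- p / 2)"
  have "restricted_potential p L c n A \<zeta> x
     = (\<Sum>q\<in>remaining_charges L c n A \<zeta>. combined_charge L c n A \<zeta> q * ?k q)"
    by (simp add: restricted_potential_def case_prod_unfold)
  also have "\<dots> = (\<Sum>q\<in>?pair ` {1..n}. combined_charge L c n A \<zeta> q * ?k q)"
    by (rule sum.mono_neutral_left) (auto simp: remaining_charges_def)
  also have "\<dots> = (\<Sum>q\<in>?pair ` {1..n}. \<Sum>j\<in>{j \<in> {1..n}. ?pair j = q}. \<zeta> j * ?k (?pair j))"
    by (simp add: combined_charge_def sum_distrib_right)
  also have "\<dots> = (\<Sum>j = 1..n. \<zeta> j * ?k (?pair j))"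
    by (rule sum.image_gen[symmetric]) simp
  finally show ?thesis by (simp add: induced_pair_def)
qed

theorem theorem1:
  fixes p :: real and n N :: nat
    and A :: "nat \<Rightarrow> real ^ 3" and \<zeta> :: "nat \<Rightarrow> real"
    and L :: "(real ^ 3) set" and c :: "real ^ 3 \<Rightarrow> real"
  assumes "p > 0" and "n \<ge> 1"
    and "affine_line L"
    and "isometric_affine_coordinate L c"
    and "N = card (remaining_charges L c n A \<zeta>)"
  shows "(\<forall>X\<in>L. (\<forall>j\<in>{1..n}. X \<noteq> A j) \<longrightarrow>
           point_charge_potential p n A \<zeta> X =
             (\<Sum>j = 1..n. \<zeta> j *
                ((c X - axial_coord L c (A j))\<^sup>2 + (infdist (A j) L)\<^sup>2) powr (- p / 2)) \<and>
           point_charge_potential p n A \<zeta> X = restricted_potential p L c n A \<zeta> (c X)) \<and>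
         (N \<ge> 1 \<longrightarrow>
           finite (critical_points p L c n A \<zeta>) \<and>
           card (critical_points p L c n A \<zeta>) \<le> 2 * N - 1 \<and>
           2 * N - 1 \<le> 2 * n - 1) \<and>
         (N = 0 \<longrightarrow>
           (\<forall>X\<in>L. (\<forall>j\<in>{1..n}. X \<noteq> A j) \<longrightarrow> point_charge_potential p n A \<zeta> X = 0) \<and>
           restriction_domain L c n A \<zeta> = UNIV \<and>
           (\<forall>x. restricted_potential p L c n A \<zeta> x = 0))"
proof -
  let ?Q = "remaining_charges L c n A \<zeta>" and ?Z = "combined_charge L c n A \<zeta>"
  have fin: "finite ?Q" by (simp add: remaining_charges_def)
  have on_line: "point_charge_potential p n A \<zeta> X = restricted_potential p L c n A \<zeta> (c X)" if "X \<in> L" for X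
    using point_charge_potential_on_line[OF assms(3,4) that] restricted_potential_combines by simp
  have "finite (critical_points p L c n A \<zeta>) \<and> card (critical_points p L c n A \<zeta>) \<le> 2 * N - 1"
    if "N \<ge> 1"
  proof -
    have pot: "restricted_potential p L c n A \<zeta> = line_potential (p / 2) ?Q ?Z"
      by (simp add: fun_eq_iff restricted_potential_def line_potential_def)
    have zero_iff: "(line_potential (p / 2) ?Q ?Z has_real_derivative 0) (at x) \<longleftrightarrow> line_force (p / 2) ?Q ?Z x = 0"
      if "(x, 0) \<notin> ?Q" for x
      using DERIV_line_potential[OF that] DERIV_unique by metis
    have "critical_points p L c n A \<zeta> = {x. (x, 0) \<notin> ?Q \<and> line_force (p / 2) ?Q ?Z x = 0}"
      unfolding critical_points_def restriction_domain_def pot using zero_iff by auto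
    moreover have "finite {x. (x, 0) \<notin> ?Q \<and> line_force (p / 2) ?Q ?Z x = 0} \<and>
        card {x. (x, 0) \<notin> ?Q \<and> line_force (p / 2) ?Q ?Z x = 0} \<le> 2 * card ?Q - 1"
    proof (rule card_zeros_line_force)
      show "?Q \<noteq> {}" using that assms(5) by auto
      show "0 \<le> snd q" if "q \<in> ?Q" for q
        using that by (auto simp: remaining_charges_def induced_pair_def infdist_nonneg)
      show "?Z q \<noteq> 0" if "q \<in> ?Q" for q using that by (simp add: remaining_charges_def)
    qed (use assms(1) fin in auto)
    ultimately show ?thesis using assms(5) by simp
  qed
  moreover have "2 * N - 1 \<le> 2 * n - 1"
  proof -
    have "N \<le> card ((\<lambda>j. induced_pair L c (A j)) ` {1..n})"
      unfolding assms(5) by (rule card_mono) (auto simp: remaining_charges_def)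
    also have "\<dots> \<le> n" using card_image_le[of "{1..n}" "\<lambda>j. induced_pair L c (A j)"] by simp
    finally show ?thesis by simp
  qed
  moreover have "?Q = {}" if "N = 0" using that fin assms(5) by simp
  ultimately show ?thesis
    using on_line point_charge_potential_on_line[OF assms(3,4)]
    by (auto simp: restriction_domain_def restricted_potential_def)
qed

end
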